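(* Let $\alpha$ be a composition of $n$, let $Y_\alpha$ be either the dual immaculate function $\mathfrak{S}^*_\alpha$ or the extended Schur function $\mathcal{E}_\alpha$, and let $d_{\alpha\beta}$ ($\beta\models n$) be the coefficients in the expansion $$Y_\alpha=\sum_{\beta\models n}d_{\alpha\beta}\frac{\Psi_\beta}{z_\beta}.$$ Then for every $\beta\models n$, $$d_{\alpha\beta}=\sum_{T\in\mathrm{BST}_{Y_\alpha}(\beta)}(-1)^{\mathrm{ht}_{Y_\alpha}(T)}.$$
   Context: For $\alpha\models n$, $\mathrm{set}(\alpha)=\{\alpha_1,\alpha_1+\alpha_2,\dots,\alpha_1+\cdots+\alpha_{\ell(\alpha)-1}\}\subseteq[n-1]$ and $\mathrm{comp}$ is the inverse bijection. $F_\alpha=\sum x_{i_1}\cdots x_{i_n}$ over $1\le i_1\le\cdots\le i_n$ with $i_j<i_{j+1}$ if $j\in\mathrm{set}(\alpha)$; $M_\alpha=\sum_{i_1<\cdots<i_k}x_{i_1}^{\alpha_1}\cdots x_{i_k}^{\alpha_k}$. Write $\beta\succeq\alpha$ if $\mathrm{set}(\beta)\subseteq\mathrm{set}(\alpha)$; then $\alpha^{(i)}\models\beta_i$ is the composition of the parts of $\alpha$ that combine to $\beta_i$. $\pi(\alpha)=\prod_{j=1}^{\ell(\alpha)}\sum_{k=1}^{j}\alpha_k$, $\pi(\alpha,\beta)=\prod_i\pi(\alpha^{(i)})$, $z_\alpha=\prod_{i\ge1}i^{m_i}m_i!$ ($m_i$ = number of parts of $\alpha$ equal to $i$), and $\Psi_\alpha=z_\alpha\sum_{\beta\succeq\alpha}\frac{1}{\pi(\alpha,\beta)}M_\beta$;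 the $\Psi_\alpha$ form a basis of $\mathbb{Q}\otimes\mathrm{QSym}$. The composition diagram $\mathtt{cd}(\alpha)$ is the left-justified array whose $i$th row from the top has $\alpha_i$ boxes; $(i,j)$ is the box in row $i$ from the top, column $j$ from the left. $\mathfrak{S}^*_\alpha=\sum_T F_{\mathrm{comp}(\mathrm{Des}(T))}$ over bijective fillings $T$ of $\mathtt{cd}(\alpha)$ by $1,\dots,n$ with rows increasing left to right and the first column increasing top to bottom; $\mathcal{E}_\alpha$ is the same sum over those fillings with rows increasing left to right and all columns increasing top to bottom; here $\mathrm{Des}(T)$ is the set of $i\in[n-1]$ with $i+1$ in a row strictly below $i$. Border strips. A skew diagram in $\mathtt{cd}(\alpha)$ is a difference of two lower sets of boxes for the order relevant to $Y_\alpha$ (generated, for $\mathfrak{S}^*_\alpha$, by moving right in rows and down the first column; for $\mathcal{E}_\alpha$, by moving right in rows and down in columns). (a) Case $Y_\alpha=\mathfrak{S}^*_\alpha$: a border strip is a connected skew diagram in $\mathtt{cd}(\alpha)$ that is either a horizontal strip (consecutive boxes in a single row) or a union of connected horizontal strips each of which intersects the first column. (b) Case $Y_\alpha=\mathcal{E}_\alpha$: a border strip is a skew diagram $B$ in $\mathtt{cd}(\alpha)$ such that: $B$ is connected, where in addition to usual (edge) adjacency, two boxes of $B$ in the same column are also considered connected when no box of $\mathtt{cd}(\alpha)\setminus B$ lies between them in that column; and if $(x,z),(y,z)\in B$ with $x<y$ then $(x,z-1)\notin B$. In either case the height $\mathrm{ht}(B)$ is one less than the number of rows containing boxes of $B$.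 Border strip tableaux. A border strip tableau of shape $\alpha$ and type $\beta$ associated with $Y_\alpha$ is an assignment of positive integers to the boxes of $\mathtt{cd}(\alpha)$ such that: entries in every row weakly increase left to right; entries in the first column (case $\mathfrak{S}^*_\alpha$), respectively in every column (case $\mathcal{E}_\alpha$), weakly increase top to bottom; the integer $i$ appears $\beta_i$ times; and the set of boxes occupied by $i$ forms a border strip associated with $Y_\alpha$. $\mathrm{BST}_{Y_\alpha}(\beta)$ is the set of these, and $\mathrm{ht}_{Y_\alpha}(T)$ is the sum of the heights of the border strips making up $T$. *)

theory Defs
  imports Complex_Main "HOL-Library.FuncSet" "HOL-Library.Poly_Mapping"
begin

section \<open>Compositions\<close>

definition compositions :: "nat \<Rightarrow> nat list set" where
  "compositions n = {\<alpha>. sum_list \<alpha> = n \<and> (\<forall>a \<in> set \<alpha>. 1 \<le> a)}"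

definition comp_set :: "nat list \<Rightarrow> nat set" where
  "comp_set \<alpha> = {sum_list (take k \<alpha>) | k. 1 \<le> k \<and> k < length \<alpha>}"

definition comp_of :: "nat \<Rightarrow> nat set \<Rightarrow> nat list" where
  "comp_of n S = the_inv_into (compositions n) comp_set S"

definition coarsenings :: "nat list \<Rightarrow> nat list set" where
  "coarsenings \<alpha> = {\<beta> \<in> compositions (sum_list \<alpha>). comp_set \<beta> \<subseteq> comp_set \<alpha>}"

text \<open>For a coarsening \<open>\<beta>\<close> of \<open>\<alpha>\<close>, the parts of \<open>\<alpha>\<close> that combine to the entry \<open>\<beta> ! i\<close>
  (list positions start at 0): those occupying a subinterval of the interval occupied by
  that entry when the parts are laid end to end.\<close>

definition block :: "nat list \<Rightarrow> nat list \<Rightarrow> nat \<Rightarrow> nat list" where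
  "block \<alpha> \<beta> i = nths \<alpha> {j. sum_list (take i \<beta>) \<le> sum_list (take j \<alpha>) \<and>
                           sum_list (take (Suc j) \<alpha>) \<le> sum_list (take (Suc i) \<beta>)}"

definition pi_comp :: "nat list \<Rightarrow> nat" where
  "pi_comp \<alpha> = (\<Prod>j = 1..length \<alpha>. sum_list (take j \<alpha>))"

definition pi_coarse :: "nat list \<Rightarrow> nat list \<Rightarrow> nat" where
  "pi_coarse \<alpha> \<beta> = (\<Prod>i < length \<beta>. pi_comp (block \<alpha> \<beta> i))"

text \<open>Integers that are not parts of \<open>\<alpha>\<close> would contribute the factor 1.\<close>

definition z_comp :: "nat list \<Rightarrow> nat" where
  "z_comp \<alpha> = (\<Prod>i \<in> set \<alpha>. i ^ count_list \<alpha> i * fact (count_list \<alpha> i))"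


section \<open>Quasisymmetric functions\<close>

text \<open>A formal power series in the commuting variables \<open>x\<^sub>1, x\<^sub>2, \<dots>\<close> is given by its coefficients;
  a monomial is given by its exponent vector.\<close>

type_synonym monomial = "nat \<Rightarrow>\<^sub>0 nat"
type_synonym series = "monomial \<Rightarrow> rat"

text \<open>The formal sum of the monomials \<open>x I\<close> over \<open>I \<in> A\<close>, for a family in which
  every monomial occurs only finitely often.\<close>

definition monomial_sum :: "'i set \<Rightarrow> ('i \<Rightarrow> monomial) \<Rightarrow> series" where
  "monomial_sum A x = (\<lambda>m. of_nat (card {I \<in> A. x I = m}))"

definition fundamental :: "nat list \<Rightarrow> series" where
  "fundamental \<alpha> = monomial_sum
     {I. length I = sum_list \<alpha> \<and> (\<forall>i \<in> set I. 1 \<le> i) \<and> sorted I \<and>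
         (\<forall>j \<in> comp_set \<alpha>. I ! (j - 1) < I ! j)}
     (\<lambda>I. \<Sum>j < sum_list \<alpha>. Poly_Mapping.single (I ! j) 1)"

definition monomial_qsym :: "nat list \<Rightarrow> series" where
  "monomial_qsym \<alpha> = monomial_sum
     {I. length I = length \<alpha> \<and> (\<forall>i \<in> set I. 1 \<le> i) \<and> sorted_wrt (<) I}
     (\<lambda>I. \<Sum>j < length \<alpha>. Poly_Mapping.single (I ! j) (\<alpha> ! j))"

definition Psi :: "nat list \<Rightarrow> series" where
  "Psi \<alpha> = (\<lambda>m. of_nat (z_comp \<alpha>) *
     (\<Sum>\<beta> \<in> coarsenings \<alpha>. 1 / of_nat (pi_coarse \<alpha> \<beta>) * monomial_qsym \<beta> m))"


section \<open>Composition diagrams and their fillings\<close>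

text \<open>A box is a pair (row, column), both counted from 1.\<close>

type_synonym box = "nat \<times> nat"

definition cd :: "nat list \<Rightarrow> box set" where
  "cd \<alpha> = {(x, z). 1 \<le> x \<and> x \<le> length \<alpha> \<and> 1 \<le> z \<and> z \<le> \<alpha> ! (x - 1)}"

definition rows_ordered :: "(nat \<Rightarrow> nat \<Rightarrow> bool) \<Rightarrow> nat list \<Rightarrow> (box \<Rightarrow> nat) \<Rightarrow> bool" where
  "rows_ordered R \<alpha> T \<longleftrightarrow>
     (\<forall>x z w. (x, z) \<in> cd \<alpha> \<and> (x, w) \<in> cd \<alpha> \<and> z < w \<longrightarrow> R (T (x, z)) (T (x, w)))"

text \<open>Columns of a composition diagram may have gaps; the comparison is between any two boxes
  of the column.\<close>

definition column_ordered ::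
    "(nat \<Rightarrow> nat \<Rightarrow> bool) \<Rightarrow> nat list \<Rightarrow> (box \<Rightarrow> nat) \<Rightarrow> nat \<Rightarrow> bool" where
  "column_ordered R \<alpha> T z \<longleftrightarrow>
     (\<forall>x y. (x, z) \<in> cd \<alpha> \<and> (y, z) \<in> cd \<alpha> \<and> x < y \<longrightarrow> R (T (x, z)) (T (y, z)))"

definition bijective_fillings :: "nat list \<Rightarrow> (box \<Rightarrow> nat) set" where
  "bijective_fillings \<alpha> =
     {T \<in> extensional (cd \<alpha>). bij_betw T (cd \<alpha>) {1..sum_list \<alpha>}}"

definition descents :: "nat list \<Rightarrow> (box \<Rightarrow> nat) \<Rightarrow> nat set" where
  "descents \<alpha> T = {i. 1 \<le> i \<and> i < sum_list \<alpha> \<and>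
     (\<exists>b \<in> cd \<alpha>. \<exists>c \<in> cd \<alpha>. T b = i \<and> T c = i + 1 \<and> fst b < fst c)}"

definition dual_immaculate :: "nat list \<Rightarrow> series" where
  "dual_immaculate \<alpha> = (\<lambda>m.
     \<Sum>T \<in> {T \<in> bijective_fillings \<alpha>. rows_ordered (<) \<alpha> T \<and> column_ordered (<) \<alpha> T 1}.
       fundamental (comp_of (sum_list \<alpha>) (descents \<alpha> T)) m)"

definition extended_schur :: "nat list \<Rightarrow> series" where
  "extended_schur \<alpha> = (\<lambda>m.
     \<Sum>T \<in> {T \<in> bijective_fillings \<alpha>. rows_ordered (<) \<alpha> T \<and> (\<forall>z. column_ordered (<) \<alpha> T z)}.
       fundamental (comp_of (sum_list \<alpha>) (descents \<alpha> T)) m)"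

datatype family = Dual_Immaculate | Extended_Schur

fun Y :: "family \<Rightarrow> nat list \<Rightarrow> series" where
  "Y Dual_Immaculate \<alpha> = dual_immaculate \<alpha>"
| "Y Extended_Schur \<alpha> = extended_schur \<alpha>"

text \<open>The columns along which the boxes are ordered.\<close>

fun relevant_column :: "family \<Rightarrow> nat \<Rightarrow> bool" where
  "relevant_column Dual_Immaculate z \<longleftrightarrow> z = 1"
| "relevant_column Extended_Schur z \<longleftrightarrow> True"


section \<open>Border strips\<close>

definition diagram_order :: "family \<Rightarrow> nat list \<Rightarrow> (box \<times> box) set" where
  "diagram_order Y\<^sub>0 \<alpha> =
     {((x, z), (y, w)). (x, z) \<in> cd \<alpha> \<and> (y, w) \<in> cd \<alpha> \<and>
        (x = y \<and> z < w \<or> z = w \<and> x < y \<and> relevant_column Y\<^sub>0 z)}\<^sup>*"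

definition lower_set :: "family \<Rightarrow> nat list \<Rightarrow> box set \<Rightarrow> bool" where
  "lower_set Y\<^sub>0 \<alpha> L \<longleftrightarrow> L \<subseteq> cd \<alpha> \<and> (\<forall>c \<in> L. \<forall>b. (b, c) \<in> diagram_order Y\<^sub>0 \<alpha> \<longrightarrow> b \<in> L)"

definition skew_diagram :: "family \<Rightarrow> nat list \<Rightarrow> box set \<Rightarrow> bool" where
  "skew_diagram Y\<^sub>0 \<alpha> B \<longleftrightarrow> (\<exists>L L'. lower_set Y\<^sub>0 \<alpha> L \<and> lower_set Y\<^sub>0 \<alpha> L' \<and> B = L - L')"

definition edge_adjacent :: "(box \<times> box) set" where
  "edge_adjacent = {((x, z), (y, w)).
     x = y \<and> (w = z + 1 \<or> z = w + 1) \<or> z = w \<and> (y = x + 1 \<or> x = y + 1)}"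

definition column_adjacent :: "nat list \<Rightarrow> box set \<Rightarrow> (box \<times> box) set" where
  "column_adjacent \<alpha> B = {((x, z), (y, w)).
     z = w \<and> (\<forall>u. min x y < u \<and> u < max x y \<longrightarrow> (u, z) \<notin> cd \<alpha> - B)}"

text \<open>Connected sets, hence border strips, are taken to be nonempty.\<close>

definition connected_via :: "(box \<times> box) set \<Rightarrow> box set \<Rightarrow> bool" where
  "connected_via A B \<longleftrightarrow> B \<noteq> {} \<and> (\<forall>b \<in> B. \<forall>c \<in> B. (b, c) \<in> (A \<inter> B \<times> B)\<^sup>*)"

definition horizontal_strip :: "box set \<Rightarrow> bool" where
  "horizontal_strip B \<longleftrightarrow> (\<exists>x p q. p \<le> q \<and> B = {x} \<times> {p..q})"

definition border_strip_dual_immaculate :: "nat list \<Rightarrow> box set \<Rightarrow> bool" where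
  "border_strip_dual_immaculate \<alpha> B \<longleftrightarrow>
     skew_diagram Dual_Immaculate \<alpha> B \<and> connected_via edge_adjacent B \<and>
     (horizontal_strip B \<or>
      (\<exists>\<S>. (\<forall>S \<in> \<S>. horizontal_strip S \<and> (\<exists>x. (x, 1) \<in> S)) \<and> B = \<Union>\<S>))"

text \<open>For \<open>z = 1\<close> the last condition is void: columns are counted from 1, so no box lies in
  column 0.\<close>

definition border_strip_extended_schur :: "nat list \<Rightarrow> box set \<Rightarrow> bool" where
  "border_strip_extended_schur \<alpha> B \<longleftrightarrow>
     skew_diagram Extended_Schur \<alpha> B \<and>
     connected_via (edge_adjacent \<union> column_adjacent \<alpha> B) B \<and>
     (\<forall>x y z. (x, z) \<in> B \<and> (y, z) \<in> B \<and> x < y \<longrightarrow> (x, z - 1) \<notin> B)"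

fun border_strip :: "family \<Rightarrow> nat list \<Rightarrow> box set \<Rightarrow> bool" where
  "border_strip Dual_Immaculate \<alpha> B \<longleftrightarrow> border_strip_dual_immaculate \<alpha> B"
| "border_strip Extended_Schur \<alpha> B \<longleftrightarrow> border_strip_extended_schur \<alpha> B"

definition strip_height :: "box set \<Rightarrow> nat" where
  "strip_height B = card (fst ` B) - 1"


section \<open>Border strip tableaux\<close>

definition occupied :: "nat list \<Rightarrow> (box \<Rightarrow> nat) \<Rightarrow> nat \<Rightarrow> box set" where
  "occupied \<alpha> T i = {b \<in> cd \<alpha>. T b = i}"

definition BST :: "family \<Rightarrow> nat list \<Rightarrow> nat list \<Rightarrow> (box \<Rightarrow> nat) set" where
  "BST Y\<^sub>0 \<alpha> \<beta> = {T \<in> cd \<alpha> \<rightarrow>\<^sub>E {1..length \<beta>}.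
     rows_ordered (\<le>) \<alpha> T \<and>
     (\<forall>z. relevant_column Y\<^sub>0 z \<longrightarrow> column_ordered (\<le>) \<alpha> T z) \<and>
     (\<forall>i \<in> {1..length \<beta>}. card (occupied \<alpha> T i) = \<beta> ! (i - 1) \<and>
                          border_strip Y\<^sub>0 \<alpha> (occupied \<alpha> T i))}"

definition tableau_height :: "nat list \<Rightarrow> (box \<Rightarrow> nat) \<Rightarrow> nat" where
  "tableau_height \<alpha> T = (\<Sum>i \<in> T ` cd \<alpha>. strip_height (occupied \<alpha> T i))"

end

theory Submission
  imports Defs
begin

text \<open>Both families are treated at once: they differ only in which columns impose an ordering.
  Comparing coefficients of \<open>x\<^sub>1^\<gamma>\<^sub>1 x\<^sub>2^\<gamma>\<^sub>2 \<cdots>\<close>, standardization turns \<open>Y\<close> into the number of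
  semistandard fillings of content \<open>\<gamma>\<close>, that is, of chains of lower sets whose successive
  differences have no two boxes in a relevant column. The claim then amounts to a
  noncommutative form of the Newton identity \<open>k h\<^sub>k = \<Sum>\<^sub>j h\<^sub>k\<^sub>-\<^sub>j p\<^sub>j\<close>: for a skew diagram \<open>D\<close> with
  \<open>k\<close> boxes, the signed number of border strips \<open>B\<close> at its upper end such that \<open>D - B\<close> has no two
  boxes in a relevant column is \<open>k\<close> if \<open>D\<close> has that property itself (every box starts
  exactly one such strip, inside its row) and \<open>0\<close> otherwise (adding or removing the part of the
  strip in one suitable row is a sign-reversing involution). Iterating this identity produces the
  weights \<open>1 / \<pi>(\<beta>, \<gamma>)\<close>, and triangularity makes the coefficients \<open>d\<close> unique.\<close>

section \<open>Compositions and refinements\<close>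

text \<open>In that identity h counts sets of boxes without two in a relevant column and p counts
  border strips with sign. The factors do not commute: a strip is removed only at the upper end of a
  skew diagram, where it carries the largest entry, so its size j is the last part of a composition.
  At that moment k boxes are present, and dividing by k contributes the last partial sum; over all
  removals the divisors are exactly the partial sums of the composition, hence \<pi>. This is the
  relation between complete functions and power sums of the first kind in noncommutative symmetric
  functions; \<open>Psi\<close> \<beta> divided by \<open>z_comp\<close> \<beta> is dual to the
  products of these power sums. Gaps in columns do no harm, because the argument uses only the order
  within a relevant column and never vertical contiguity; the adjacency conventions of both kinds of
  border strips are reduced to this order. Monomials whose variables are an initial segment suffice,
  since there the monomial quasisymmetric function of \<beta> has coefficient 1 at the exponent
  vector \<beta> and 0 at all other compositions.\<close>

declare sum_list_eq_0_iff [simp del]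

definition positive :: "nat list \<Rightarrow> bool" where
  "positive \<beta> \<longleftrightarrow> (\<forall>a \<in> set \<beta>. 1 \<le> a)"

text \<open>Unlike \<open>comp_set\<close>, this includes 0 and the total, so that it behaves well under append.\<close>

definition psums :: "nat list \<Rightarrow> nat set" where
  "psums \<beta> = (\<lambda>j. sum_list (take j \<beta>)) ` {..length \<beta>}"

lemma compositions_iff: "\<beta> \<in> compositions n \<longleftrightarrow> sum_list \<beta> = n \<and> positive \<beta>"
  by (simp add: compositions_def positive_def)

lemma positive_append [simp]: "positive (\<beta> @ \<gamma>) \<longleftrightarrow> positive \<beta> \<and> positive \<gamma>"
  by (auto simp: positive_def)

lemma positive_Cons [simp]: "positive (a # \<beta>) \<longleftrightarrow> 1 \<le> a \<and> positive \<beta>"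
  by (auto simp: positive_def)

lemma positive_Nil [simp]: "positive []"
  by (simp add: positive_def)

lemma positive_take: "positive \<beta> \<Longrightarrow> positive (take j \<beta>)"
  by (auto simp: positive_def dest: in_set_takeD)

lemma positive_drop: "positive \<beta> \<Longrightarrow> positive (drop j \<beta>)"
  by (auto simp: positive_def dest: in_set_dropD)

lemma length_le_sum_list: "positive \<beta> \<Longrightarrow> length \<beta> \<le> sum_list \<beta>"
  by (induction \<beta>) auto

lemma sum_list_take_mono: "i \<le> j \<Longrightarrow> sum_list (take i \<beta>) \<le> sum_list (take j (\<beta> :: nat list))"
  by (metis le_add1 le_add_diff_inverse sum_list_append take_add)

lemma sum_list_take_le: "sum_list (take j \<beta>) \<le> sum_list (\<beta> :: nat list)"
  by (metis le_add1 append_take_drop_id sum_list_append)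

lemma sum_list_take_strict_mono:
  assumes "positive \<beta>" "i < j" "j \<le> length \<beta>"
  shows "sum_list (take i \<beta>) < sum_list (take j \<beta>)"
proof -
  have "take (Suc i) \<beta> = take i \<beta> @ [\<beta> ! i]"
    using assms by (simp add: take_Suc_conv_app_nth)
  moreover have "1 \<le> \<beta> ! i"
    using assms by (auto simp: positive_def)
  ultimately have "sum_list (take i \<beta>) < sum_list (take (Suc i) \<beta>)"
    by simp
  also have "\<dots> \<le> sum_list (take j \<beta>)"
    using assms by (intro sum_list_take_mono) auto
  finally show ?thesis .
qed

lemma finite_psums [simp]: "finite (psums \<beta>)"
  by (simp add: psums_def)

lemma card_psums: "positive \<beta> \<Longrightarrow> card (psums \<beta>) = Suc (length \<beta>)"
proof -
  assume p: "positive \<beta>"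
  have "inj_on (\<lambda>j. sum_list (take j \<beta>)) {..length \<beta>}"
  proof (rule linorder_inj_onI)
    fix i j assume "i < j" "i \<in> {..length \<beta>}" "j \<in> {..length \<beta>}"
    then show "sum_list (take i \<beta>) \<noteq> sum_list (take j \<beta>)"
      using sum_list_take_strict_mono[OF p, of i j] by auto
  qed auto
  then show ?thesis by (simp add: psums_def card_image)
qed

lemma sum_in_psums [simp]: "sum_list \<beta> \<in> psums \<beta>"
  unfolding psums_def by (rule image_eqI[of _ _ "length \<beta>"]) auto

lemma zero_in_psums [simp]: "0 \<in> psums \<beta>"
  unfolding psums_def by (rule image_eqI[of _ _ 0]) auto

lemma psums_le: "s \<in> psums \<beta> \<Longrightarrow> s \<le> sum_list \<beta>"
  using sum_list_take_le by (auto simp: psums_def)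

lemma psums_Nil [simp]: "psums [] = {0}"
  by (simp add: psums_def)

lemma psums_append: "psums (\<beta> @ \<delta>) = psums \<beta> \<union> (\<lambda>s. sum_list \<beta> + s) ` psums \<delta>"
proof (intro equalityI subsetI)
  fix s assume "s \<in> psums (\<beta> @ \<delta>)"
  then obtain j where j: "j \<le> length \<beta> + length \<delta>" "s = sum_list (take j (\<beta> @ \<delta>))"
    by (auto simp: psums_def)
  show "s \<in> psums \<beta> \<union> (\<lambda>s. sum_list \<beta> + s) ` psums \<delta>"
  proof (cases "j \<le> length \<beta>")
    case True then show ?thesis using j by (auto simp: psums_def)
  next
    case False
    then have "s = sum_list \<beta> + sum_list (take (j - length \<beta>) \<delta>)" "j - length \<beta> \<le> length \<delta>"
      using j by auto
    then show ?thesis by (auto simp: psums_def)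
  qed
next
  fix s assume "s \<in> psums \<beta> \<union> (\<lambda>s. sum_list \<beta> + s) ` psums \<delta>"
  then consider j where "j \<le> length \<beta>" "s = sum_list (take j \<beta>)"
    | j where "j \<le> length \<delta>" "s = sum_list \<beta> + sum_list (take j \<delta>)"
    by (auto simp: psums_def)
  then show "s \<in> psums (\<beta> @ \<delta>)"
  proof cases
    case 1
    then show ?thesis unfolding psums_def by (intro image_eqI[of _ _ j]) auto
  next
    case 2
    then show ?thesis unfolding psums_def by (intro image_eqI[of _ _ "length \<beta> + j"]) auto
  qed
qed

lemma psums_single: "psums [k] = {0, k}"
  by (auto simp: psums_def atMost_Suc)

lemma psums_snoc: "psums (\<beta> @ [k]) = insert (sum_list \<beta> + k) (psums \<beta>)"
  by (auto simp: psums_append psums_single)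

lemma Max_psums: "Max (psums \<beta>) = sum_list \<beta>"
  by (rule Max_eqI) (simp_all add: psums_le)

text \<open>The total is the maximum of the set; removing it leaves the partial sums of the list
  without its last part, so the list can be read off from its end.\<close>

lemma psums_inject: "positive \<beta> \<Longrightarrow> positive \<gamma> \<Longrightarrow> psums \<beta> = psums \<gamma> \<Longrightarrow> \<beta> = \<gamma>"
proof (induction \<beta> arbitrary: \<gamma> rule: rev_induct)
  case Nil
  have "Suc (length \<gamma>) = Suc (length ([] :: nat list))"
    unfolding card_psums[OF Nil.prems(1), symmetric] card_psums[OF Nil.prems(2), symmetric]
    unfolding Nil.prems(3) ..
  then show ?case by simp
next
  case (snoc k \<beta>)
  have "\<gamma> \<noteq> []"
    using snoc.prems card_psums[of "\<beta> @ [k]"] by auto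
  then obtain \<gamma>' k' where g: "\<gamma> = \<gamma>' @ [k']"
    by (metis rev_exhaust)
  have s: "sum_list \<beta> + k = sum_list \<gamma>' + k'"
    using snoc.prems(3) Max_psums[of "\<beta> @ [k]"] Max_psums[of "\<gamma>' @ [k']"] g by simp
  have "psums \<beta> = psums (\<beta> @ [k]) - {sum_list \<beta> + k}"
    using snoc.prems(1) by (auto simp: psums_snoc dest: psums_le)
  moreover have "psums \<gamma>' = psums (\<gamma>' @ [k']) - {sum_list \<gamma>' + k'}"
    using snoc.prems(2) g by (auto simp: psums_snoc dest: psums_le)
  ultimately have "psums \<beta> = psums \<gamma>'" using s snoc.prems(3) g by simp
  then have "\<beta> = \<gamma>'" using snoc.IH[of \<gamma>'] snoc.prems g by auto
  then show ?case using g s by auto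
qed

text \<open>Adding a new maximum b to the set corresponds to appending the part b minus the current
  total, which is positive because the total itself is an element below b.\<close>

lemma exists_psums:
  assumes "finite S" "0 \<notin> S"
  shows "\<exists>\<beta>. positive \<beta> \<and> psums \<beta> = insert 0 S"
  using assms
proof (induction S rule: finite_linorder_max_induct)
  case empty
  then show ?case by (intro exI[of _ "[]"]) auto
next
  case (insert b A)
  then obtain \<beta> where b: "positive \<beta>" "psums \<beta> = insert 0 A" by auto
  have lt: "sum_list \<beta> < b"
  proof -
    have "sum_list \<beta> \<in> insert 0 A" "0 < b" using b(2)[symmetric] insert.prems by auto
    then show ?thesis using insert.hyps by auto
  qed
  show ?case
    by (rule exI[of _ "\<beta> @ [b - sum_list \<beta>]"]) (use b lt in \<open>auto simp: psums_snoc\<close>)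
qed

section \<open>The bijection between compositions of n and subsets of [n-1]\<close>

lemma comp_set_eq:
  assumes "positive \<beta>"
  shows "comp_set \<beta> = psums \<beta> - {0, sum_list \<beta>}"
proof (intro equalityI subsetI)
  fix s assume "s \<in> comp_set \<beta>"
  then obtain k where k: "1 \<le> k" "k < length \<beta>" "s = sum_list (take k \<beta>)"
    by (auto simp: comp_set_def)
  have "0 < s" "s < sum_list \<beta>"
    using sum_list_take_strict_mono[OF assms, of 0 k]
      sum_list_take_strict_mono[OF assms, of k "length \<beta>"] k by auto
  then show "s \<in> psums \<beta> - {0, sum_list \<beta>}"
    using k by (auto simp: psums_def)
next
  fix s assume "s \<in> psums \<beta> - {0, sum_list \<beta>}"
  then obtain k where k: "k \<le> length \<beta>" "s = sum_list (take k \<beta>)" "s \<noteq> 0" "s \<noteq> sum_list \<beta>"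
    by (auto simp: psums_def)
  then have "k \<noteq> 0" "k \<noteq> length \<beta>" by (auto intro: gr0I)
  then have "1 \<le> k \<and> k < length \<beta>" using k by auto
  then show "s \<in> comp_set \<beta>"
    using k unfolding comp_set_def by blast
qed

lemma inj_on_comp_set: "inj_on comp_set (compositions n)"
proof (rule inj_onI)
  fix \<beta> \<gamma> assume *: "\<beta> \<in> compositions n" "\<gamma> \<in> compositions n" "comp_set \<beta> = comp_set \<gamma>"
  have "psums \<delta> = insert 0 (insert n (comp_set \<delta>))" if "\<delta> \<in> compositions n" for \<delta>
    using that sum_in_psums[of \<delta>] by (auto simp: comp_set_eq compositions_iff)
  then show "\<beta> = \<gamma>" using * psums_inject by (metis compositions_iff)
qed

text \<open>\<open>comp_of\<close> is an inverse chosen by \<open>the_inv_into\<close>, about which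
  nothing is known until S is exhibited as the set of an actual composition;
  \<open>exists_psums\<close> supplies that composition.\<close>

lemma comp_of:
  assumes "S \<subseteq> {1..<n}"
  shows "comp_of n S \<in> compositions n" "comp_set (comp_of n S) = S"
proof -
  have "finite (insert n S - {0})" using assms finite_subset by auto
  then obtain \<beta> where b: "positive \<beta>" "psums \<beta> = insert 0 (insert n S - {0})"
    using exists_psums[of "insert n S - {0}"] by auto
  then have b2: "psums \<beta> = insert 0 (insert n S)" by auto
  have fin: "finite S" using assms finite_subset by auto
  have "sum_list \<beta> = n"
    unfolding Max_psums[symmetric] b2 by (rule Max_eqI) (use assms fin in auto)
  then have "\<beta> \<in> compositions n" "comp_set \<beta> = S"
    using b b2 assms by (auto simp: compositions_iff comp_set_eq)
  then have "S \<in> comp_set ` compositions n" by auto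
  then show "comp_of n S \<in> compositions n" "comp_set (comp_of n S) = S"
    unfolding comp_of_def using inj_on_comp_set
    by (auto intro!: the_inv_into_into f_the_inv_into_f)
qed

lemma finite_compositions [simp]: "finite (compositions n)"
proof (rule finite_subset)
  show "compositions n \<subseteq> {\<beta>. set \<beta> \<subseteq> {..n} \<and> length \<beta> \<le> n}"
    using length_le_sum_list by (auto simp: compositions_iff member_le_sum_list)
qed (simp add: finite_lists_length_le)

lemma positive_sum_0_iff: "sum_list \<beta> = 0 \<and> positive \<beta> \<longleftrightarrow> \<beta> = []"
  using length_le_sum_list[of \<beta>] by auto

lemma compositions_0 [simp]: "compositions 0 = {[]}"
  by (simp add: set_eq_iff compositions_iff positive_sum_0_iff)

text \<open>The part split off is the last one because the recursion over strips removes the largest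
  entry.\<close>

lemma sum_compositions_snoc:
  assumes "0 < k"
  shows "(\<Sum>\<delta> \<in> compositions k. f \<delta>) = (\<Sum>j = 1..k. \<Sum>\<delta> \<in> compositions (k - j). f (\<delta> @ [j]))"
proof -
  have "(\<Sum>j = 1..k. \<Sum>\<delta> \<in> compositions (k - j). f (\<delta> @ [j])) =
      (\<Sum>(j, \<delta>) \<in> Sigma {1..k} (\<lambda>j. compositions (k - j)). f (\<delta> @ [j]))"
    by (subst sum.Sigma) auto
  also have "\<dots> = (\<Sum>\<delta> \<in> compositions k. f \<delta>)"
  proof (rule sum.reindex_bij_witness[where j = "\<lambda>(j, \<delta>). \<delta> @ [j]" and i = "\<lambda>\<delta>. (last \<delta>, butlast \<delta>)"])
    fix \<delta> assume d: "\<delta> \<in> compositions k"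
    then have "\<delta> \<noteq> []" using assms by (auto simp: compositions_iff)
    then obtain \<delta>' j where "\<delta> = \<delta>' @ [j]" by (metis rev_exhaust)
    then show "(last \<delta>, butlast \<delta>) \<in> Sigma {1..k} (\<lambda>j. compositions (k - j))"
      "(\<lambda>(j, \<delta>). \<delta> @ [j]) (last \<delta>, butlast \<delta>) = \<delta>"
      using d by (auto simp: compositions_iff)
  qed (auto simp: compositions_iff)
  finally show ?thesis by simp
qed

text \<open>The transpose of \<open>coarsenings\<close>: the coefficient of the monomial of \<gamma>
  picks one term out of each \<open>Psi\<close> \<beta>, so sums over coarsenings of \<beta> turn
  into sums over refinements of \<gamma>.\<close>

definition refinements :: "nat list \<Rightarrow> nat list set" where
  "refinements \<gamma> = {\<beta> \<in> compositions (sum_list \<gamma>). \<gamma> \<in> coarsenings \<beta>}"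

lemma refinements_iff:
  assumes "positive \<gamma>"
  shows "\<beta> \<in> refinements \<gamma> \<longleftrightarrow> positive \<beta> \<and> sum_list \<beta> = sum_list \<gamma> \<and> psums \<gamma> \<subseteq> psums \<beta>"
proof -
  have "0 \<in> psums \<beta>" "sum_list \<beta> \<in> psums \<beta>" by simp_all
  then show ?thesis
    using assms by (auto simp: refinements_def coarsenings_def compositions_iff comp_set_eq)
qed

lemma finite_refinements [simp]: "finite (refinements \<gamma>)"
  by (simp add: refinements_def)

lemma refinements_Nil [simp]: "refinements [] = {[]}"
proof -
  have "\<beta> \<in> refinements [] \<longleftrightarrow> \<beta> = []" for \<beta>
    unfolding refinements_iff[OF positive_Nil] using positive_sum_0_iff[of \<beta>] by auto
  then show ?thesis by blast
qed

text \<open>A refinement of the longer list has the total of \<gamma> among its partial sums and is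
  cut there. Positivity makes partial sums strictly increasing, so the place of the cut is
  unique.\<close>

lemma bij_betw_refinements_snoc:
  assumes "positive (\<gamma> @ [k])"
  shows "bij_betw (\<lambda>x. fst x @ snd x) (refinements \<gamma> \<times> compositions k) (refinements (\<gamma> @ [k]))"
  unfolding bij_betw_def
  proof
    show "inj_on (\<lambda>x. fst x @ snd x) (refinements \<gamma> \<times> compositions k)"
    proof (rule inj_onI, clarsimp)
      fix \<beta> \<delta> \<beta>' \<delta>'
      assume *: "\<beta> \<in> refinements \<gamma>" "\<beta>' \<in> refinements \<gamma>" "\<beta> @ \<delta> = \<beta>' @ \<delta>'"
      then have s: "sum_list \<beta> = sum_list \<beta>'" "positive \<beta>" "positive \<beta>'"
        using assms by (auto simp: refinements_iff)
      have len: "length \<beta> = length \<beta>'"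
      proof (rule ccontr)
        assume "length \<beta> \<noteq> length \<beta>'"
        then consider "length \<beta> < length \<beta>'" | "length \<beta>' < length \<beta>" by linarith
        then show False
        proof cases
          case 1
          then have "sum_list (take (length \<beta>) \<beta>') < sum_list \<beta>'"
            using sum_list_take_strict_mono[OF s(3), of "length \<beta>" "length \<beta>'"] by simp
          moreover have "take (length \<beta>) \<beta>' = \<beta>"
            using *(3) 1 by (metis append_eq_append_conv_if less_imp_le)
          ultimately show False using s by simp
        next
          case 2
          then have "sum_list (take (length \<beta>') \<beta>) < sum_list \<beta>"
            using sum_list_take_strict_mono[OF s(2), of "length \<beta>'" "length \<beta>"] by simp
          moreover have "take (length \<beta>') \<beta> = \<beta>'"
            using *(3) 2 by (metis append_eq_append_conv_if not_less)
          ultimately show False using s by simp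
        qed
      qed
      then show "\<beta> = \<beta>' \<and> \<delta> = \<delta>'" using *(3) by simp
    qed
    show "(\<lambda>x. fst x @ snd x) ` (refinements \<gamma> \<times> compositions k) = refinements (\<gamma> @ [k])"
    proof (intro equalityI subsetI)
      fix \<beta> assume "\<beta> \<in> (\<lambda>x. fst x @ snd x) ` (refinements \<gamma> \<times> compositions k)"
      then obtain \<beta>' \<delta> where b: "\<beta> = \<beta>' @ \<delta>" "\<beta>' \<in> refinements \<gamma>" "\<delta> \<in> compositions k"
        by auto
      have "sum_list \<beta> \<in> psums \<beta>" by (rule sum_in_psums)
      then show "\<beta> \<in> refinements (\<gamma> @ [k])"
        using assms b by (auto simp: refinements_iff compositions_iff psums_append psums_single)
    next
      fix \<beta> assume "\<beta> \<in> refinements (\<gamma> @ [k])"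
      then have b: "positive \<beta>" "sum_list \<beta> = sum_list \<gamma> + k" "psums (\<gamma> @ [k]) \<subseteq> psums \<beta>"
        using assms by (auto simp: refinements_iff)
      have "sum_list \<gamma> \<in> psums \<beta>" using b(3) by (auto simp: psums_snoc)
      then obtain j where j: "j \<le> length \<beta>" "sum_list (take j \<beta>) = sum_list \<gamma>"
        by (auto simp: psums_def)
      \<comment> \<open>Partial sums of \<gamma> do not exceed its total, so in \<beta> they are
        reached no later than the cut.\<close>
      have "psums \<gamma> \<subseteq> psums (take j \<beta>)"
      proof
        fix s assume s: "s \<in> psums \<gamma>"
        then have "s \<in> psums \<beta>" using b by (auto simp: psums_snoc)
        then obtain i where i: "i \<le> length \<beta>" "s = sum_list (take i \<beta>)"
          by (auto simp: psums_def)
        have "i \<le> j"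
        proof (rule ccontr)
          assume "\<not> i \<le> j"
          then have "sum_list \<gamma> < s"
            using sum_list_take_strict_mono[OF b(1), of j i] i j by auto
          then show False using psums_le[OF s] by simp
        qed
        then have "s = sum_list (take i (take j \<beta>))" using i by (simp add: min_def)
        then show "s \<in> psums (take j \<beta>)"
          using \<open>i \<le> j\<close> j by (auto simp: psums_def)
      qed
      then have "take j \<beta> \<in> refinements \<gamma>"
        using b j assms by (auto simp: refinements_iff positive_take)
      moreover have "sum_list \<beta> = sum_list (take j \<beta>) + sum_list (drop j \<beta>)"
        by (metis append_take_drop_id sum_list_append)
      then have "drop j \<beta> \<in> compositions k"
        using b j by (auto simp: compositions_iff positive_drop)
      ultimately show "\<beta> \<in> (\<lambda>x. fst x @ snd x) ` (refinements \<gamma> \<times> compositions k)"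
        by (intro image_eqI[of _ _ "(take j \<beta>, drop j \<beta>)"]) auto
    qed
  qed

lemma sum_refinements_snoc:
  assumes "positive (\<gamma> @ [k])"
  shows "(\<Sum>\<beta> \<in> refinements (\<gamma> @ [k]). f \<beta>) =
    (\<Sum>\<beta> \<in> refinements \<gamma>. \<Sum>\<delta> \<in> compositions k. f (\<beta> @ \<delta>))"
  using sum.reindex_bij_betw[OF bij_betw_refinements_snoc[OF assms], of f]
  by (simp add: sum.cartesian_product case_prod_unfold)

text \<open>This strictness is what makes the system of coefficient equations triangular.\<close>

lemma refinements_length:
  assumes "positive \<gamma>" "\<beta> \<in> refinements \<gamma>" "\<beta> \<noteq> \<gamma>"
  shows "length \<gamma> < length \<beta>"
proof -
  have *: "positive \<beta>" "psums \<gamma> \<subseteq> psums \<beta>"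
    using assms by (auto simp: refinements_iff)
  then have "psums \<gamma> \<subset> psums \<beta>"
    using assms psums_inject by blast
  then have "card (psums \<gamma>) < card (psums \<beta>)"
    by (simp add: psubset_card_mono)
  then show ?thesis using assms * by (simp add: card_psums)
qed

section \<open>Products of partial sums and their behaviour under append\<close>

lemma pi_comp_snoc: "pi_comp (\<beta> @ [k]) = pi_comp \<beta> * (sum_list \<beta> + k)"
proof -
  have "(\<Prod>j = 1..length \<beta>. sum_list (take j (\<beta> @ [k]))) = (\<Prod>j = 1..length \<beta>. sum_list (take j \<beta>))"
    by (intro prod.cong) auto
  then show ?thesis by (simp add: pi_comp_def)
qed

lemma nths_cong: "(\<And>j. j < length xs \<Longrightarrow> j \<in> A \<longleftrightarrow> j \<in> B) \<Longrightarrow> nths xs A = nths xs B"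
  unfolding nths_def by (intro arg_cong[of _ _ "map fst"] filter_cong) (auto simp: set_zip)

text \<open>Blocks are defined by containment of intervals. The parts of \<beta> end at the total of
  \<gamma> or before and those of \<delta> start there or later; having positive length, no part
  fits into a block on the other side.\<close>

lemma pi_coarse_snoc:
  assumes "positive \<beta>" "positive \<delta>" "sum_list \<beta> = sum_list \<gamma>" "sum_list \<delta> = k"
  shows "pi_coarse (\<beta> @ \<delta>) (\<gamma> @ [k]) = pi_coarse \<beta> \<gamma> * pi_comp \<delta>"
proof -
  have bl: "block (\<beta> @ \<delta>) (\<gamma> @ [k]) i = block \<beta> \<gamma> i" if i: "i < length \<gamma>" for i
  proof -
    have 1: "sum_list (take (Suc i) (\<gamma> @ [k])) \<le> sum_list \<beta>"
      using i assms(3) sum_list_take_le[of "Suc i" \<gamma>] by simp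
    have 2: "nths \<delta> {j. j + length \<beta> \<in> {j. sum_list (take i (\<gamma> @ [k])) \<le> sum_list (take j (\<beta> @ \<delta>)) \<and>
        sum_list (take (Suc j) (\<beta> @ \<delta>)) \<le> sum_list (take (Suc i) (\<gamma> @ [k]))}} = nths \<delta> {}"
    proof (rule nths_cong)
      fix j assume j: "j < length \<delta>"
      have "sum_list (take (length \<beta>) (\<beta> @ \<delta>)) < sum_list (take (Suc (j + length \<beta>)) (\<beta> @ \<delta>))"
        using assms j by (intro sum_list_take_strict_mono) auto
      then show "(j \<in> {j. j + length \<beta> \<in> {j. sum_list (take i (\<gamma> @ [k])) \<le> sum_list (take j (\<beta> @ \<delta>)) \<and>
        sum_list (take (Suc j) (\<beta> @ \<delta>)) \<le> sum_list (take (Suc i) (\<gamma> @ [k]))}}) = (j \<in> {})"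
        using 1 by auto
    qed
    have 3: "nths \<beta> {j. sum_list (take i (\<gamma> @ [k])) \<le> sum_list (take j (\<beta> @ \<delta>)) \<and>
        sum_list (take (Suc j) (\<beta> @ \<delta>)) \<le> sum_list (take (Suc i) (\<gamma> @ [k]))} = block \<beta> \<gamma> i"
      unfolding block_def by (rule nths_cong) (use i in auto)
    show ?thesis
      unfolding block_def[of "\<beta> @ \<delta>"] nths_append 2 3 by simp
  qed
  have last: "block (\<beta> @ \<delta>) (\<gamma> @ [k]) (length \<gamma>) = \<delta>"
  proof -
    have 1: "nths \<beta> {j. sum_list (take (length \<gamma>) (\<gamma> @ [k])) \<le> sum_list (take j (\<beta> @ \<delta>)) \<and>
        sum_list (take (Suc j) (\<beta> @ \<delta>)) \<le> sum_list (take (Suc (length \<gamma>)) (\<gamma> @ [k]))} = nths \<beta> {}"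
    proof (rule nths_cong)
      fix j assume j: "j < length \<beta>"
      have "sum_list (take j \<beta>) < sum_list (take (length \<beta>) \<beta>)"
        using assms j by (intro sum_list_take_strict_mono) auto
      then show "(j \<in> {j. sum_list (take (length \<gamma>) (\<gamma> @ [k])) \<le> sum_list (take j (\<beta> @ \<delta>)) \<and>
        sum_list (take (Suc j) (\<beta> @ \<delta>)) \<le> sum_list (take (Suc (length \<gamma>)) (\<gamma> @ [k]))}) = (j \<in> {})"
        using assms j by auto
    qed
    have 2: "nths \<delta> {j. j + length \<beta> \<in> {j. sum_list (take (length \<gamma>) (\<gamma> @ [k])) \<le> sum_list (take j (\<beta> @ \<delta>)) \<and>
        sum_list (take (Suc j) (\<beta> @ \<delta>)) \<le> sum_list (take (Suc (length \<gamma>)) (\<gamma> @ [k]))}} = nths \<delta> UNIV"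
      using sum_list_take_le assms by (intro nths_cong) (auto simp: Suc_diff_le)
    show ?thesis
      unfolding block_def nths_append 1 2 by (simp add: nths_all)
  qed
  show ?thesis
    by (simp add: pi_coarse_def bl last)
qed

lemma pi_comp_pos: "positive \<beta> \<Longrightarrow> 0 < pi_comp \<beta>"
proof (induction \<beta> rule: rev_induct)
  case Nil
  then show ?case by (simp add: pi_comp_def)
next
  case (snoc k \<beta>)
  then show ?case unfolding pi_comp_snoc by simp
qed

lemma pi_coarse_refl_pos: "positive \<gamma> \<Longrightarrow> 0 < pi_coarse \<gamma> \<gamma>"
proof (induction \<gamma> rule: rev_induct)
  case Nil
  then show ?case by (simp add: pi_coarse_def)
next
  case (snoc k \<gamma>)
  then have "pi_coarse (\<gamma> @ [k]) (\<gamma> @ [k]) = pi_coarse \<gamma> \<gamma> * pi_comp [k]"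
    by (intro pi_coarse_snoc) simp_all
  moreover have "0 < pi_comp [k]" using snoc.prems by (intro pi_comp_pos) simp
  moreover have "0 < pi_coarse \<gamma> \<gamma>" using snoc by simp
  ultimately show ?case by simp
qed

lemma z_comp_pos: "positive \<beta> \<Longrightarrow> 0 < z_comp \<beta>"
  unfolding z_comp_def by (intro prod_pos) (auto simp: positive_def)

section \<open>Border strips at the upper end of a skew diagram\<close>

lemma relevant_column_1 [simp]: "relevant_column F (Suc 0)"
  by (cases F) auto

lemma cd_row: "(x, z) \<in> cd \<alpha> \<Longrightarrow> 1 \<le> w \<Longrightarrow> w \<le> z \<Longrightarrow> (x, w) \<in> cd \<alpha>"
  by (auto simp: cd_def)

lemma cd_pos: "(x, z) \<in> cd \<alpha> \<Longrightarrow> 1 \<le> z"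
  by (auto simp: cd_def)

lemma cd_eq: "cd \<alpha> = Sigma {1..length \<alpha>} (\<lambda>x. {1..\<alpha> ! (x - 1)})"
  by (auto simp: cd_def)

lemma finite_cd [simp]: "finite (cd \<alpha>)"
  by (simp add: cd_eq)

lemma card_cd: "card (cd \<alpha>) = sum_list \<alpha>"
proof -
  have "card (cd \<alpha>) = (\<Sum>x = 1..length \<alpha>. \<alpha> ! (x - 1))"
    by (simp add: cd_eq)
  also have "\<dots> = (\<Sum>x < length \<alpha>. \<alpha> ! x)"
    by (rule sum.reindex_bij_witness[of _ Suc "\<lambda>x. x - 1"]) auto
  finally show ?thesis by (simp add: sum_list_sum_nth lessThan_atLeast0)
qed

text \<open>Closure under a reflexive transitive closure is closure under its generators. Rows have
  no gaps, so every earlier column counts; columns may have gaps, so membership of the upper box in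
  the diagram has to be asked for.\<close>

lemma lower_set_iff:
  "lower_set F \<alpha> L \<longleftrightarrow> L \<subseteq> cd \<alpha> \<and>
     (\<forall>x z w. (x, z) \<in> L \<and> 1 \<le> w \<and> w < z \<longrightarrow> (x, w) \<in> L) \<and>
     (\<forall>x y z. (x, z) \<in> L \<and> (y, z) \<in> cd \<alpha> \<and> y < x \<and> relevant_column F z \<longrightarrow> (y, z) \<in> L)"
  (is "?l \<longleftrightarrow> ?r")
proof
  assume l: ?l
  then have sub: "L \<subseteq> cd \<alpha>" and
    cl: "\<And>b c. c \<in> L \<Longrightarrow> (b, c) \<in> diagram_order F \<alpha> \<Longrightarrow> b \<in> L"
    by (auto simp: lower_set_def)
  show ?r
  proof (intro conjI allI impI sub)
    fix x z w assume *: "(x, z) \<in> L \<and> 1 \<le> w \<and> w < z"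
    then have "(x, z) \<in> cd \<alpha>" "(x, w) \<in> cd \<alpha>" using sub cd_row[of x z] by auto
    then have "((x, w), (x, z)) \<in> diagram_order F \<alpha>"
      unfolding diagram_order_def using * by (intro r_into_rtrancl) auto
    then show "(x, w) \<in> L" using cl * by blast
  next
    fix x y z assume *: "(x, z) \<in> L \<and> (y, z) \<in> cd \<alpha> \<and> y < x \<and> relevant_column F z"
    then have "((y, z), (x, z)) \<in> diagram_order F \<alpha>"
      unfolding diagram_order_def using sub by (intro r_into_rtrancl) auto
    then show "(y, z) \<in> L" using cl * by blast
  qed
next
  assume r: ?r
  have "b \<in> L" if "(b, c) \<in> diagram_order F \<alpha>" "c \<in> L" for b c
    using that unfolding diagram_order_def
  proof (induction rule: converse_rtrancl_induct)
    case base
    then show ?case by simp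
  next
    case (step a b)
    obtain x z y w where ab: "a = (x, z)" "b = (y, w)" by (cases a, cases b)
    with step have *: "(x, z) \<in> cd \<alpha>" "x = y \<and> z < w \<or> z = w \<and> x < y \<and> relevant_column F z"
      and b: "(y, w) \<in> L"
      by auto
    from *(2) show ?case
    proof
      assume "x = y \<and> z < w"
      then show ?thesis using r b cd_pos[OF *(1)] ab by blast
    next
      assume "z = w \<and> x < y \<and> relevant_column F z"
      then show ?thesis using r b *(1) ab by blast
    qed
  qed
  then show ?l using r unfolding lower_set_def by blast
qed

lemma lower_set_subset: "lower_set F \<alpha> L \<Longrightarrow> L \<subseteq> cd \<alpha>"
  by (simp add: lower_set_def)

lemma lower_set_row: "lower_set F \<alpha> L \<Longrightarrow> (x, z) \<in> L \<Longrightarrow> 1 \<le> w \<Longrightarrow> w \<le> z \<Longrightarrow> (x, w) \<in> L"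
  unfolding lower_set_iff le_less by blast

lemma lower_set_column:
  "lower_set F \<alpha> L \<Longrightarrow> (x, z) \<in> L \<Longrightarrow> (y, z) \<in> cd \<alpha> \<Longrightarrow> y \<le> x \<Longrightarrow> relevant_column F z \<Longrightarrow>
    (y, z) \<in> L"
  unfolding lower_set_iff le_less by blast

lemma lower_set_cd [simp]: "lower_set F \<alpha> (cd \<alpha>)"
  using cd_row by (auto simp: lower_set_iff)

lemma finite_lower_sets [simp]: "finite {M. lower_set F \<alpha> M \<and> P M}"
  by (rule finite_subset[of _ "Pow (cd \<alpha>)"]) (auto simp: lower_set_def)

text \<open>Connectivity without paths: to confine a connected set one exhibits a nonempty closed
  subset. For the converse, the closed subset is the set of boxes reachable from b.\<close>

lemma connected_via_iff:
  "connected_via A B \<longleftrightarrow> B \<noteq> {} \<and>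
    (\<forall>S. S \<subseteq> B \<and> S \<noteq> {} \<and> (\<forall>b \<in> S. \<forall>c \<in> B. (b, c) \<in> A \<longrightarrow> c \<in> S) \<longrightarrow> S = B)"
  (is "?l \<longleftrightarrow> ?r")
proof
  assume l: ?l
  show ?r
  proof (intro conjI allI impI)
    show "B \<noteq> {}" using l by (simp add: connected_via_def)
    fix S assume S: "S \<subseteq> B \<and> S \<noteq> {} \<and> (\<forall>b \<in> S. \<forall>c \<in> B. (b, c) \<in> A \<longrightarrow> c \<in> S)"
    then obtain b where b: "b \<in> S" by auto
    have "c \<in> S" if "c \<in> B" for c
    proof -
      have "(b, c) \<in> (A \<inter> B \<times> B)\<^sup>*" using l b that S by (auto simp: connected_via_def)
      then show ?thesis
        by (induction rule: rtrancl_induct) (use b S in auto)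
    qed
    then show "S = B" using S by auto
  qed
next
  assume r: ?r
  have "(b, c) \<in> (A \<inter> B \<times> B)\<^sup>*" if "b \<in> B" "c \<in> B" for b c
  proof -
    have "{c \<in> B. (b, c) \<in> (A \<inter> B \<times> B)\<^sup>*} = B"
    proof (rule r[THEN conjunct2, rule_format], intro conjI ballI impI)
      show "{c \<in> B. (b, c) \<in> (A \<inter> B \<times> B)\<^sup>*} \<noteq> {}" using that by blast
    next
      fix c d assume "c \<in> {c \<in> B. (b, c) \<in> (A \<inter> B \<times> B)\<^sup>*}" "d \<in> B" "(c, d) \<in> A"
      then show "d \<in> {c \<in> B. (b, c) \<in> (A \<inter> B \<times> B)\<^sup>*}"
        by (auto intro: rtrancl_into_rtrancl[of b c])
    qed auto
    then show ?thesis using that by auto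
  qed
  then show ?l using r by (auto simp: connected_via_def)
qed

text \<open>Inside a skew diagram, this adjacency relation gives a description of border strips common to
  both families (\<open>border_strip_iff_ribbon\<close>).\<close>

definition link :: "family \<Rightarrow> (box \<times> box) set" where
  "link F = {((x, z), (y, w)). x = y \<and> (w = z + 1 \<or> z = w + 1) \<or> z = w \<and> relevant_column F z}"

definition ribbon :: "family \<Rightarrow> box set \<Rightarrow> bool" where
  "ribbon F B \<longleftrightarrow> connected_via (link F) B \<and>
     (\<forall>x y z. (x, z) \<in> B \<and> (y, z) \<in> B \<and> x < y \<and> relevant_column F z \<longrightarrow> (x, z - 1) \<notin> B)"

text \<open>The sets of boxes that may share one entry in a semistandard filling; they take the
  place of the complete functions h.\<close>

definition column_free :: "family \<Rightarrow> box set \<Rightarrow> bool" where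
  "column_free F B \<longleftrightarrow> (\<forall>x y z. (x, z) \<in> B \<and> (y, z) \<in> B \<and> relevant_column F z \<longrightarrow> x = y)"

text \<open>The contribution of one strip to the power sum p. The value 0 off ribbons lets sums run
  over all lower sets or all fillings.\<close>

definition strip_sign :: "family \<Rightarrow> box set \<Rightarrow> rat" where
  "strip_sign F B = (if ribbon F B then (-1) ^ strip_height B else 0)"

lemma link_iff: "((x, z), (y, w)) \<in> link F \<longleftrightarrow>
    x = y \<and> (w = z + 1 \<or> z = w + 1) \<or> z = w \<and> relevant_column F z"
  by (auto simp: link_def)

text \<open>A closed set that contains one point of a segment spreads along it in both directions.
  The map \<open>g\<close> is left open so that the same argument serves rows and the first
  column.\<close>

lemma segment_closed:
  fixes g :: "nat \<Rightarrow> 'a"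
  assumes seg: "\<And>v. p \<le> v \<Longrightarrow> v \<le> q \<Longrightarrow> g v \<in> B"
    and adj: "\<And>v. (g v, g (Suc v)) \<in> A" "\<And>v. (g (Suc v), g v) \<in> A"
    and cl: "\<And>b c. b \<in> S \<Longrightarrow> c \<in> B \<Longrightarrow> (b, c) \<in> A \<Longrightarrow> c \<in> S"
    and S: "g u \<in> S" "p \<le> u" "u \<le> q"
    and v: "p \<le> v" "v \<le> q"
  shows "g v \<in> S"
proof (cases "u \<le> v")
  case True
  then have "v \<le> q \<longrightarrow> g v \<in> S"
  proof (induction v rule: dec_induct)
    case base
    then show ?case using S by simp
  next
    case (step n)
    then show ?case using cl[OF _ seg adj(1), of n] S by simp
  qed
  then show ?thesis using v by simp
next
  case False
  then have "v \<le> u" by simp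
  then have "p \<le> v \<longrightarrow> g v \<in> S"
  proof (induction v rule: inc_induct)
    case base
    then show ?case using S by simp
  next
    case (step n)
    then show ?case using cl[OF _ seg adj(2), of n] S by simp
  qed
  then show ?thesis using v by simp
qed

lemma row_segment_closed:
  assumes "\<And>v. p \<le> v \<Longrightarrow> v \<le> q \<Longrightarrow> (x, v) \<in> B"
    and "\<And>b c. b \<in> S \<Longrightarrow> c \<in> B \<Longrightarrow> (b, c) \<in> link F \<Longrightarrow> c \<in> S"
    and "(x, u) \<in> S" "p \<le> u" "u \<le> q" "p \<le> v" "v \<le> q"
  shows "(x, v) \<in> S"
  by (rule segment_closed[where g = "Pair x" and A = "link F" and B = B, OF assms(1) _ _ assms(2-7)])
    (simp_all add: link_iff)

section \<open>The Newton identity for the skew diagram D = \<open>L - L'\<close>\<close>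

locale nested_lower_sets =
  fixes F :: family and \<alpha> :: "nat list" and L L' :: "box set"
  assumes lower: "lower_set F \<alpha> L" "lower_set F \<alpha> L'" and sub: "L' \<subseteq> L"
begin

lemma in_cd: "b \<in> L \<Longrightarrow> b \<in> cd \<alpha>"
  using lower lower_set_subset by blast

lemma finite_L: "finite L"
  using lower(1) finite_subset[OF _ finite_cd, of L \<alpha>] by (simp add: lower_set_def)

lemmas row_below = lower_set_row[OF lower(1)] lower_set_row[OF lower(2)]

lemmas column_below = lower_set_column[OF lower(1)] lower_set_column[OF lower(2)]

lemma skew_pos: "(x, z) \<in> L - L' \<Longrightarrow> 1 \<le> z"
  using in_cd cd_pos by blast

lemma skew_row:
  assumes "(x, z) \<in> L - L'" "(x, w) \<in> L" "z \<le> w"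
  shows "(x, w) \<in> L - L'"
  using assms row_below(2)[of x w z] skew_pos[of x z] by blast

lemma skew_row_between:
  assumes "(x, z) \<in> L - L'" "(x, w) \<in> L" "z \<le> v" "v \<le> w"
  shows "(x, v) \<in> L - L'"
  using assms row_below(1)[of x w v] skew_row[of x z v] skew_pos[of x z] by simp

lemma skew_column:
  assumes "(x, z) \<in> L - L'" "(y, z) \<in> L" "x \<le> y" "relevant_column F z"
  shows "(y, z) \<in> L - L'"
  using assms column_below(2)[of y z x] in_cd[of "(x, z)"] by blast

text \<open>B is an upper set of L: a box left behind in \<open>L - B\<close> would drag every box
  before it in its row into \<open>L - B\<close> as well.\<close>

lemma upper_row:
  assumes "B \<subseteq> L - L'" "lower_set F \<alpha> (L - B)" "(x, z) \<in> B" "(x, w) \<in> L" "z \<le> w"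
  shows "(x, w) \<in> B"
proof (rule ccontr)
  assume "(x, w) \<notin> B"
  then have "(x, w) \<in> L - B" using assms by blast
  moreover have "1 \<le> z" using assms(1,3) skew_pos by blast
  ultimately have "(x, z) \<in> L - B" using lower_set_row[OF assms(2)] assms(5) by blast
  then show False using assms(3) by blast
qed

lemma upper_column:
  assumes "B \<subseteq> L - L'" "lower_set F \<alpha> (L - B)" "(x, z) \<in> B" "(y, z) \<in> L" "x \<le> y" "relevant_column F z"
  shows "(y, z) \<in> B"
proof (rule ccontr)
  assume "(y, z) \<notin> B"
  then have "(y, z) \<in> L - B" using assms by blast
  moreover have "(x, z) \<in> cd \<alpha>" using assms(1,3) in_cd by blast
  ultimately have "(x, z) \<in> L - B" using lower_set_column[OF assms(2)] assms(5,6) by blast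
  then show False using assms(3) by blast
qed

text \<open>The terms of the Newton identity that do not vanish, indexed by the removed strip
  instead of the remaining lower set \<open>L - B\<close>, because the involution below acts on
  strips.\<close>

definition strips :: "box set set" where
  "strips = {B. B \<subseteq> L - L' \<and> lower_set F \<alpha> (L - B) \<and> ribbon F B \<and> column_free F (L - L' - B)}"

lemma sum_intermediate_eq_strips:
  "(\<Sum>M \<in> {M. lower_set F \<alpha> M \<and> L' \<subseteq> M \<and> M \<subseteq> L}.
      strip_sign F (L - M) * of_bool (column_free F (M - L'))) = (\<Sum>B \<in> strips. (-1) ^ strip_height B)"
  (is "sum ?f ?I = _")
proof -
  have "sum ?f ?I = sum ?f {M \<in> ?I. ribbon F (L - M) \<and> column_free F (M - L')}"
    by (rule sum.mono_neutral_right) (auto simp: strip_sign_def)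
  also have "\<dots> = (\<Sum>B \<in> strips. (-1) ^ strip_height B)"
  proof (rule sum.reindex_bij_witness[of _ "\<lambda>B. L - B" "\<lambda>M. L - M"])
    fix B assume B: "B \<in> strips"
    then have "L - (L - B) = B" "L - L' - B = L - B - L'" by (auto simp: strips_def)
    then show "L - (L - B) = B" "L - B \<in> {M \<in> ?I. ribbon F (L - M) \<and> column_free F (M - L')}"
      using B sub by (auto simp: strips_def)
  next
    fix M assume M: "M \<in> {M \<in> ?I. ribbon F (L - M) \<and> column_free F (M - L')}"
    then have "L - (L - M) = M" "L - L' - (L - M) = M - L'" by auto
    then show "L - (L - M) = M" "L - M \<in> strips" "(-1) ^ strip_height (L - M) = ?f M"
      using M by (auto simp: strips_def strip_sign_def)
  qed
  finally show ?thesis .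
qed

text \<open>Links between different rows need two boxes in one relevant column, so here a ribbon
  stays in its row; being an upper set, it is the tail of that row from some box on. All heights are
  0 and each box contributes 1.\<close>

lemma strips_column_free:
  assumes free: "column_free F (L - L')"
  shows "(\<Sum>B \<in> strips. (-1) ^ strip_height B) = (of_nat (card (L - L')) :: rat)"
proof -
  define suffix where "suffix = (\<lambda>(x, z). {(y, w). (y, w) \<in> L - L' \<and> y = x \<and> z \<le> w})"
  have suffix_mem: "(y, w) \<in> suffix (x, z) \<longleftrightarrow> (x, w) \<in> L - L' \<and> y = x \<and> z \<le> w" for x y z w
    by (auto simp: suffix_def)
  have sfx: "suffix b \<in> strips \<and> strip_height (suffix b) = 0" if b: "b \<in> L - L'" for b
  proof -
    obtain x z where xz: "b = (x, z)" by (cases b)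
    have self: "(x, z) \<in> suffix b" using b xz by (simp add: suffix_mem)
    have 1: "suffix b \<subseteq> L - L'" by (auto simp: suffix_def split: prod.splits)
    \<comment> \<open>Only columns can obstruct this: a box of L below a box of the tail in a
      relevant column would also belong to D, which is column-free.\<close>
    have 2: "lower_set F \<alpha> (L - suffix b)"
      unfolding lower_set_iff
    proof (intro conjI allI impI)
      show "L - suffix b \<subseteq> cd \<alpha>" using in_cd by auto
    next
      fix y w v assume *: "(y, w) \<in> L - suffix b \<and> 1 \<le> v \<and> v < w"
      then have "(y, v) \<in> L" using row_below(1)[of y w v] by auto
      moreover have "(y, v) \<notin> suffix b"
        using * skew_row[of y v w] by (auto simp: xz suffix_mem)
      ultimately show "(y, v) \<in> L - suffix b" by auto
    next
      fix y y' w assume *: "(y, w) \<in> L - suffix b \<and> (y', w) \<in> cd \<alpha> \<and> y' < y \<and> relevant_column F w"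
      then have "(y', w) \<in> L" using column_below(1)[of y w y'] by auto
      moreover have "(y', w) \<notin> suffix b"
      proof
        assume a: "(y', w) \<in> suffix b"
        then have "(y', w) \<in> L - L'" using 1 by blast
        moreover from this have "(y, w) \<in> L - L'" using skew_column[of y' w y] * by auto
        ultimately show False using free * unfolding column_free_def by blast
      qed
      ultimately show "(y', w) \<in> L - suffix b" by auto
    qed
    have 3: "ribbon F (suffix b)"
      unfolding ribbon_def connected_via_iff
    proof (intro conjI allI impI)
      show "suffix b \<noteq> {}" using self by auto
    next
      fix S assume S: "S \<subseteq> suffix b \<and> S \<noteq> {} \<and>
        (\<forall>b' \<in> S. \<forall>c \<in> suffix b. (b', c) \<in> link F \<longrightarrow> c \<in> S)"
      then obtain b' where b': "b' \<in> S" "b' \<in> suffix b" by blast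
      then obtain u where "b' = (x, u)" by (auto simp: xz suffix_def)
      with b' have u: "(x, u) \<in> S" "(x, u) \<in> suffix b" by simp_all
      have "(x, v) \<in> S" if v: "(x, v) \<in> suffix b" for v
      proof (rule row_segment_closed[where p = z and q = "max u v" and B = "suffix b" and F = F])
        fix w assume "z \<le> w" "w \<le> max u v"
        then show "(x, w) \<in> suffix b"
          using skew_row_between[of x z "max u v" w] u v b
          by (auto simp: xz suffix_mem max_def split: if_splits)
      qed (use S u v in \<open>auto simp: xz suffix_mem\<close>)
      then show "S = suffix b" using S by (auto simp: xz suffix_def)
    next
      fix y y' w assume "(y, w) \<in> suffix b \<and> (y', w) \<in> suffix b \<and> y < y' \<and> relevant_column F w"
      then show "(y, w - 1) \<notin> suffix b" by (auto simp: xz suffix_def)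
    qed
    have 4: "column_free F (L - L' - suffix b)"
      using free unfolding column_free_def by blast
    have "fst ` suffix b = {x}" using self by (force simp: xz suffix_def)
    then show ?thesis using 1 2 3 4 by (simp add: strips_def strip_height_def)
  qed
  have inj: "inj_on suffix (L - L')"
  proof (rule inj_onI)
    fix b c assume *: "b \<in> L - L'" "c \<in> L - L'" "suffix b = suffix c"
    have "b \<in> suffix b" "c \<in> suffix c" using *(1,2) by (auto simp: suffix_def split: prod.splits)
    then have "b \<in> suffix c" "c \<in> suffix b" using *(3) by auto
    then show "b = c" by (auto simp: suffix_def split: prod.splits)
  qed
  have surj: "\<exists>b \<in> L - L'. B = suffix b" if B: "B \<in> strips" for B
  proof -
    have B': "B \<subseteq> L - L'" "lower_set F \<alpha> (L - B)" "ribbon F B"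
      using B by (auto simp: strips_def)
    then have con: "connected_via (link F) B" by (simp add: ribbon_def)
    then obtain x u where xu: "(x, u) \<in> B" unfolding connected_via_def by fastforce
    \<comment> \<open>The boxes of B in row x are closed under links, hence are all of B.\<close>
    have row: "{b \<in> B. fst b = x} = B"
    proof (rule con[unfolded connected_via_iff, THEN conjunct2, rule_format], intro conjI ballI impI)
      fix b c assume *: "b \<in> {b \<in> B. fst b = x}" "c \<in> B" "(b, c) \<in> link F"
      obtain y w where c: "c = (y, w)" by (cases c)
      obtain v where b: "b = (x, v)" using * by (cases b) auto
      have "b \<in> L - L'" "c \<in> L - L'" using * B' by auto
      then have "y = x" using *(3) free unfolding b c link_iff column_free_def by blast
      then show "c \<in> {b \<in> B. fst b = x}" using * c by auto
    qed (use xu in auto)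
    define z where "z = (LEAST z. (x, z) \<in> B)"
    have z: "(x, z) \<in> B" unfolding z_def by (rule LeastI[of _ u]) (rule xu)
    have "B = suffix (x, z)"
    proof (intro equalityI subsetI)
      fix b assume b: "b \<in> B"
      then have "b \<in> {b \<in> B. fst b = x}" unfolding row .
      then obtain w where w: "b = (x, w)" by (cases b) auto
      then have "z \<le> w" unfolding z_def using b by (auto intro: Least_le)
      then show "b \<in> suffix (x, z)" using b w B' by (auto simp: suffix_mem)
    next
      fix b assume b: "b \<in> suffix (x, z)"
      then obtain w where w: "b = (x, w)" by (auto simp: suffix_def)
      then show "b \<in> B" using upper_row[OF B'(1,2) z, of w] b by (auto simp: suffix_mem)
    qed
    then show ?thesis using z B' by auto
  qed
  have img: "suffix ` (L - L') = strips" using sfx surj by blast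
  have "(\<Sum>B \<in> strips. (-1) ^ strip_height B) = (\<Sum>b \<in> L - L'. (-1) ^ strip_height (suffix b) :: rat)"
    unfolding img[symmetric] by (subst sum.reindex[OF inj]) simp
  also have "\<dots> = (\<Sum>b \<in> L - L'. 1)"
    by (intro sum.cong refl) (use sfx in auto)
  finally show ?thesis by simp
qed

text \<open>Let \<open>r\<close> be the topmost row with a box having another box of the skew diagram below it in a
  relevant column, let \<open>t\<close> be the last column of such a box in row \<open>r\<close>, and let \<open>R\<close> be the part of
  row \<open>r\<close> from column \<open>t\<close> on. Every strip contains \<open>R\<close> or avoids row \<open>r\<close>, and \<open>R\<close> is attached
  to the rest of the strip through column \<open>t\<close> only, so \<open>R\<close> can be added or removed freely.\<close>

lemma strips_not_column_free:
  assumes not_free: "\<not> column_free F (L - L')"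
  shows "(\<Sum>B \<in> strips. (-1) ^ strip_height B) = (0 :: rat)"
proof -
  \<comment> \<open>Of two boxes of D in a relevant column, the upper one is blocked and the lower
    one is covered. Blocked boxes locate the involution; covered boxes describe what every strip
    must contain.\<close>
  define blocked where "blocked x z \<longleftrightarrow> (x, z) \<in> L - L' \<and> relevant_column F z \<and> (\<exists>y > x. (y, z) \<in> L - L')" for x z
  define covered where "covered x z \<longleftrightarrow> (x, z) \<in> L - L' \<and> relevant_column F z \<and> (\<exists>y < x. (y, z) \<in> L - L')" for x z
  have covered_blocked: "\<exists>y < x. blocked y z" if "covered x z" for x z
    using that unfolding covered_def blocked_def by blast
  have blocked_covered: "\<exists>y > x. covered y z" if "blocked x z" for x z
    using that unfolding covered_def blocked_def by blast
  have ex: "\<exists>x z. blocked x z"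
  proof -
    obtain x y z where *: "(x, z) \<in> L - L'" "(y, z) \<in> L - L'" "relevant_column F z" "x \<noteq> y"
      using not_free unfolding column_free_def by blast
    then show ?thesis
      unfolding blocked_def by (metis linorder_neqE_nat)
  qed
  define r where "r = (LEAST x. \<exists>z. blocked x z)"
  have ex_r: "\<exists>z. blocked r z"
    unfolding r_def using ex by (rule LeastI_ex)
  have r_least: "r \<le> x" if "blocked x z" for x z
    unfolding r_def using that by (auto intro: Least_le)
  \<comment> \<open>A box above a covered one is blocked and would lie in a row before the topmost
    row r.\<close>
  have r_uncovered: "\<not> covered r z" for z
    using covered_blocked r_least by fastforce
  have fin: "finite {z. blocked r z}"
    by (rule finite_subset[of _ "snd ` L"]) (force simp: blocked_def, simp add: finite_L)
  define t where "t = Max {z. blocked r z}"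
  have t: "blocked r t"
    using Max_in[OF fin] ex_r unfolding t_def by auto
  have t_max: "z \<le> t" if "blocked r z" for z
    unfolding t_def using that fin by (intro Max_ge) auto
  obtain r' where r': "r < r'" "covered r' t" using blocked_covered[OF t] by blast
  have t_D: "(r, t) \<in> L - L'" "relevant_column F t" using t by (auto simp: blocked_def)
  define R where "R = {(y, w). (y, w) \<in> L - L' \<and> y = r \<and> t \<le> w}"
  have R_iff: "(y, w) \<in> R \<longleftrightarrow> (r, w) \<in> L - L' \<and> y = r \<and> t \<le> w" for y w
    by (auto simp: R_def)
  have t_R: "(r, t) \<in> R" using t_D by (auto simp: R_iff)
  have R_seg: "(r, v) \<in> R" if "(r, w) \<in> R" "t \<le> v" "v \<le> w" for v w
    using that skew_row_between[of r t w v] t_D by (auto simp: R_iff)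
  \<comment> \<open>Minimality of r excludes partners above row r, and maximality of t excludes
    partners in columns after t.\<close>
  have R_partner: "w = t \<and> r < y" if "(r, w) \<in> R" "(y, w) \<in> L - L'" "relevant_column F w" "y \<noteq> r" for y w
  proof -
    have "r < y"
    proof (rule ccontr)
      assume "\<not> r < y"
      then have "y < r" using that(4) by simp
      then have "covered r w" using that unfolding covered_def R_iff by blast
      then show False using r_uncovered by blast
    qed
    moreover from this have "blocked r w" using that by (auto simp: blocked_def R_iff)
    ultimately show ?thesis using t_max[of w] that by (auto simp: R_iff)
  qed
  \<comment> \<open>If B misses a covered box then, as an upper set, it also misses the boxes above
    it, and two boxes of one relevant column remain. If B contains all covered boxes, each relevant
    column keeps at most its top box.\<close>
  have free_iff: "column_free F (L - L' - B) \<longleftrightarrow> (\<forall>x z. covered x z \<longrightarrow> (x, z) \<in> B)"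
    if B: "B \<subseteq> L - L'" "lower_set F \<alpha> (L - B)" for B
  proof
    assume f: "column_free F (L - L' - B)"
    show "\<forall>x z. covered x z \<longrightarrow> (x, z) \<in> B"
    proof (intro allI impI, rule ccontr)
      fix x z assume c: "covered x z" and n: "(x, z) \<notin> B"
      then obtain y where y: "y < x" "(y, z) \<in> L - L'" "(x, z) \<in> L - L'" "relevant_column F z"
        by (auto simp: covered_def)
      have "(y, z) \<notin> B" using upper_column[OF B, of y z x] y n by auto
      then show False using f y n unfolding column_free_def by blast
    qed
  next
    assume c: "\<forall>x z. covered x z \<longrightarrow> (x, z) \<in> B"
    show "column_free F (L - L' - B)"
      unfolding column_free_def
    proof (intro allI impI, rule ccontr)
      fix x y z assume *: "(x, z) \<in> L - L' - B \<and> (y, z) \<in> L - L' - B \<and> relevant_column F z" "x \<noteq> y"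
      then consider "covered x z" | "covered y z"
        unfolding covered_def by (metis Diff_iff linorder_neqE_nat)
      then show False using c * by cases auto
    qed
  qed
  define toggle where "toggle B = (if (r, t) \<in> B then B - R else B \<union> R)" for B
  \<comment> \<open>The covered box \<open>(r', t)\<close> lies in every strip. If
    \<open>(r, t)\<close> does too, the ribbon condition forbids \<open>(r, t - 1)\<close>, and
    upper closure then forbids everything further left. If \<open>(r, t)\<close> does not, boxes of
    the strip in row r would have to lie after column t, cut off from
    \<open>(r', t)\<close>.\<close>
  have toggle_row: "(\<forall>w. (r, w) \<notin> B) \<or> {b \<in> B. fst b = r} = R" if B: "B \<in> strips" for B
  proof -
    have B': "B \<subseteq> L - L'" "lower_set F \<alpha> (L - B)" "ribbon F B"
      and cov: "\<And>x z. covered x z \<Longrightarrow> (x, z) \<in> B"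
      using B free_iff by (auto simp: strips_def)
    show ?thesis
    proof (cases "(r, t) \<in> B")
      case True
      have "(r, w) \<notin> B" if w: "w < t" for w
      proof
        assume wB: "(r, w) \<in> B"
        have "(r, t - 1) \<in> B"
        proof (rule upper_row[OF B'(1,2) wB])
          show "(r, t - 1) \<in> L"
            using row_below(1)[of r t "t - 1"] t_D w B' skew_pos[of r w] wB by auto
        qed (use w in simp)
        moreover have "(r', t) \<in> B" using cov r' by auto
        ultimately show False
          using B'(3) True r' t_D unfolding ribbon_def by blast
      qed
      then have "w \<ge> t" if "(r, w) \<in> B" for w using that not_le by blast
      then have "{b \<in> B. fst b = r} \<subseteq> R" using B' by (auto simp: R_iff)
      moreover have "R \<subseteq> B"
        using upper_row[OF B'(1,2) True] by (auto simp: R_def)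
      ultimately show ?thesis by (auto simp: R_def)
    next
      case False
      have "(r, w) \<notin> B" for w
      proof
        assume w: "(r, w) \<in> B"
        have gt: "t < v" if "(r, v) \<in> B" for v
          using upper_row[OF B'(1,2) that, of t] False t_D by fastforce
        \<comment> \<open>After column t no box of row r has a partner in D, so links cannot leave
          the row.\<close>
        have one_row: "{b \<in> B. fst b = r} = B"
        proof (rule B'(3)[unfolded ribbon_def connected_via_iff, THEN conjunct1, THEN conjunct2, rule_format],
            intro conjI ballI impI)
          fix b c assume *: "b \<in> {b \<in> B. fst b = r}" "c \<in> B" "(b, c) \<in> link F"
          obtain y v where c: "c = (y, v)" by (cases c)
          obtain u where b: "b = (r, u)" using * by (cases b) auto
          have "y = r"
          proof (rule ccontr)
            assume ne: "y \<noteq> r"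
            then have "v = u" "relevant_column F u" using *(3) by (auto simp: b c link_iff)
            moreover have "(r, u) \<in> R" using gt[of u] * b B' by (auto simp: R_iff)
            ultimately show False using R_partner[of u y] ne gt[of u] * B' b c by auto
          qed
          then show "c \<in> {b \<in> B. fst b = r}" using * c by auto
        qed (use w in auto)
        have "(r', t) \<in> B" using cov r' by auto
        then have "(r', t) \<in> {b \<in> B. fst b = r}" unfolding one_row .
        then show False using r' by simp
      qed
      then show ?thesis by blast
    qed
  qed
  have toggle_strip: "B \<in> strips \<longleftrightarrow> B \<union> R \<in> strips"
    if Br: "\<And>w. (r, w) \<notin> B" for B
  \<comment> \<open>Row r has no covered boxes, so a failure of this condition is shared by B and
    \<open>B \<union> R\<close>; both then fail to be strips.\<close>
  proof (cases "B \<subseteq> L - L' \<and> (\<forall>x z. covered x z \<longrightarrow> (x, z) \<in> B)")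
    case False
    have "B \<notin> strips" using False free_iff[of B] by (auto simp: strips_def)
    moreover have "B \<union> R \<notin> strips"
    proof
      assume a: "B \<union> R \<in> strips"
      then have sub: "B \<union> R \<subseteq> L - L'" by (auto simp: strips_def)
      then have "\<forall>x z. covered x z \<longrightarrow> (x, z) \<in> B \<union> R" using free_iff[OF sub] a by (auto simp: strips_def)
      then have "\<forall>x z. covered x z \<longrightarrow> (x, z) \<in> B" using r_uncovered by (auto simp: R_iff)
      then show False using False sub by auto
    qed
    ultimately show ?thesis by simp
  next
    case True
    then have BD: "B \<subseteq> L - L'" and cov: "\<And>x z. covered x z \<Longrightarrow> (x, z) \<in> B" by auto
    have BRD: "B \<union> R \<subseteq> L - L'" using BD by (auto simp: R_def)
    have r'B: "(r', t) \<in> B" using cov r' by auto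
    \<comment> \<open>Adding R is harmless because boxes of D below R in a relevant column are
      covered and so already in B. Removing R is harmless because B has no box in row r, and the
      partners of R lie below R, never above it.\<close>
    have low_iff: "lower_set F \<alpha> (L - B) \<longleftrightarrow> lower_set F \<alpha> (L - (B \<union> R))"
    proof
      assume l: "lower_set F \<alpha> (L - B)"
      show "lower_set F \<alpha> (L - (B \<union> R))"
        unfolding lower_set_iff
      proof (intro conjI allI impI)
        show "L - (B \<union> R) \<subseteq> cd \<alpha>" using in_cd by auto
      next
        fix x z w assume *: "(x, z) \<in> L - (B \<union> R) \<and> 1 \<le> w \<and> w < z"
        then have "(x, w) \<in> L - B" using lower_set_row[OF l, of x z w] by auto
        moreover have "(x, w) \<notin> R"
          using * skew_row[of r w z] by (auto simp: R_iff)
        ultimately show "(x, w) \<in> L - (B \<union> R)" by auto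
      next
        fix x y z assume *: "(x, z) \<in> L - (B \<union> R) \<and> (y, z) \<in> cd \<alpha> \<and> y < x \<and> relevant_column F z"
        then have "(y, z) \<in> L - B" using lower_set_column[OF l, of x z y] by auto
        moreover have "(y, z) \<notin> R"
        proof
          assume a: "(y, z) \<in> R"
          then have yz: "(y, z) \<in> L - L'" by (auto simp: R_def)
          then have "(x, z) \<in> L - L'" using * skew_column[of y z x] by auto
          then have "covered x z" using * yz by (auto simp: covered_def)
          then show False using cov * by auto
        qed
        ultimately show "(y, z) \<in> L - (B \<union> R)" by auto
      qed
    next
      assume l: "lower_set F \<alpha> (L - (B \<union> R))"
      show "lower_set F \<alpha> (L - B)"
        unfolding lower_set_iff
      proof (intro conjI allI impI)
        show "L - B \<subseteq> cd \<alpha>" using in_cd by auto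
      next
        fix x z w assume *: "(x, z) \<in> L - B \<and> 1 \<le> w \<and> w < z"
        show "(x, w) \<in> L - B"
        proof (cases "(x, z) \<in> R")
          case True
          then show ?thesis using * Br row_below(1)[of x z w] by (auto simp: R_iff)
        next
          case False
          then show ?thesis using * lower_set_row[OF l, of x z w] by auto
        qed
      next
        fix x y z assume *: "(x, z) \<in> L - B \<and> (y, z) \<in> cd \<alpha> \<and> y < x \<and> relevant_column F z"
        show "(y, z) \<in> L - B"
        proof (cases "(x, z) \<in> R")
          case True
          have "(y, z) \<in> L" using * column_below(1)[of x z y] by auto
          moreover have "(y, z) \<notin> B"
            using R_partner[of z y] True * BD by (force simp: R_iff)
          ultimately show ?thesis by simp
        next
          case False
          then show ?thesis using * lower_set_column[OF l, of x z y] by auto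
        qed
      qed
    qed
    \<comment> \<open>R is a connected row segment attached through the link between
      \<open>(r, t)\<close> and \<open>(r', t)\<close>. Conversely, every box of B linked to R lies
      in column t; such boxes are linked to each other, so paths through R can be shortened inside
      B.\<close>
    have con_iff: "connected_via (link F) B \<longleftrightarrow> connected_via (link F) (B \<union> R)"
    proof
      assume con: "connected_via (link F) B"
      show "connected_via (link F) (B \<union> R)"
        unfolding connected_via_iff
      proof (intro conjI allI impI)
        show "B \<union> R \<noteq> {}" using t_R by auto
        fix S assume S: "S \<subseteq> B \<union> R \<and> S \<noteq> {} \<and> (\<forall>b \<in> S. \<forall>c \<in> B \<union> R. (b, c) \<in> link F \<longrightarrow> c \<in> S)"
        have R_in: "R \<subseteq> S" if "(r, u) \<in> S" "(r, u) \<in> R" for u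
        proof
          fix c assume "c \<in> R"
          then obtain v where c: "c = (r, v)" "(r, v) \<in> R" by (auto simp: R_def)
          have "(r, v) \<in> S"
          proof (rule row_segment_closed[where p = t and q = "max u v" and B = "B \<union> R" and F = F])
            fix w assume "t \<le> w" "w \<le> max u v"
            then show "(r, w) \<in> B \<union> R"
              using R_seg[of u w] R_seg[of v w] that c by (auto simp: max_def split: if_splits)
          qed (use S that c in \<open>auto simp: R_iff\<close>)
          then show "c \<in> S" using c by simp
        qed
        have "S \<inter> B \<noteq> {}"
        proof
          assume e: "S \<inter> B = {}"
          then obtain u where "(r, u) \<in> S" "(r, u) \<in> R" using S by (force simp: R_def)
          then have "(r, t) \<in> S" using R_in t_R by auto
          then have "(r', t) \<in> S" using S r'B t_D by (auto simp: link_iff)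
          then show False using e r'B by auto
        qed
        then have "S \<inter> B = B"
          using S by (intro con[unfolded connected_via_iff, THEN conjunct2, rule_format]) blast
        then have "(r', t) \<in> S" using r'B by auto
        then have "(r, t) \<in> S" using S t_R t_D by (auto simp: link_iff)
        then have "R \<subseteq> S" using R_in t_R by auto
        then show "S = B \<union> R" using \<open>S \<inter> B = B\<close> S by auto
      qed
    next
      assume con: "connected_via (link F) (B \<union> R)"
      show "connected_via (link F) B"
        unfolding connected_via_iff
      proof (intro conjI allI impI)
        show "B \<noteq> {}" using r'B by auto
        fix S assume S: "S \<subseteq> B \<and> S \<noteq> {} \<and> (\<forall>b \<in> S. \<forall>c \<in> B. (b, c) \<in> link F \<longrightarrow> c \<in> S)"
        have to_t: "w = t \<and> v = t \<and> relevant_column F t"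
          if "(y, v) \<in> B" "(r, w) \<in> R" "((y, v), (r, w)) \<in> link F \<or> ((r, w), (y, v)) \<in> link F" for y v w
          using that Br[of v] R_partner[of w y] BD by (auto simp: link_iff)
        show "S = B"
        \<comment> \<open>If S meets column t, adjoining R gives a closed subset of
          \<open>B \<union> R\<close>. If it does not, S is closed in \<open>B \<union> R\<close> by
          itself, hence equal to it, and then contains \<open>(r, t)\<close> after all.\<close>
        proof (cases "\<exists>y. (y, t) \<in> S")
          case True
          then obtain y where y: "(y, t) \<in> S" by blast
          have "S \<union> R = B \<union> R"
          proof (rule con[unfolded connected_via_iff, THEN conjunct2, rule_format], intro conjI ballI impI)
            fix b c assume *: "b \<in> S \<union> R" "c \<in> B \<union> R" "(b, c) \<in> link F"
            show "c \<in> S \<union> R"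
            proof (cases "c \<in> R")
              case False
              then have cB: "c \<in> B" using * by auto
              show ?thesis
              proof (cases "b \<in> S")
                case True
                then show ?thesis using S cB *(3) by auto
              next
                case False
                then obtain w where w: "b = (r, w)" "(r, w) \<in> R" using * by (auto simp: R_def)
                obtain y' v where c: "c = (y', v)" by (cases c)
                have "v = t" "relevant_column F t" using to_t[of y' v w] cB w c *(3) by auto
                then have "((y, t), c) \<in> link F" by (auto simp: c link_iff)
                then show ?thesis using S y cB by auto
              qed
            qed auto
          qed (use S in auto)
          moreover have "B \<inter> R = {}" "S \<inter> R = {}" using Br S by (auto simp: R_def)
          ultimately show ?thesis by blast
        next
          case False
          have "S = B \<union> R"
          proof (rule con[unfolded connected_via_iff, THEN conjunct2, rule_format], intro conjI ballI impI)
            fix b c assume *: "b \<in> S" "c \<in> B \<union> R" "(b, c) \<in> link F"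
            obtain y v where b: "b = (y, v)" by (cases b)
            have "c \<notin> R"
            proof
              assume "c \<in> R"
              then obtain w where w: "c = (r, w)" "(r, w) \<in> R" by (auto simp: R_def)
              then have "v = t" using to_t[of y v w] * b S by auto
              then show False using False * b by auto
            qed
            then show "c \<in> S" using * S by auto
          qed (use S in auto)
          then show ?thesis using t_R False by auto
        qed
      qed
    qed
    \<comment> \<open>The lower box of a pair is covered and so lies in B. If the upper box lies in
      row r, its column is t, and \<open>(r, t - 1)\<close> is in neither B nor R; columns start at
      1, so \<open>t - 1\<close> really is smaller than t.\<close>
    have cond_iff: "(\<forall>x y z. (x, z) \<in> B \<and> (y, z) \<in> B \<and> x < y \<and> relevant_column F z \<longrightarrow> (x, z - 1) \<notin> B) \<longleftrightarrow>
      (\<forall>x y z. (x, z) \<in> B \<union> R \<and> (y, z) \<in> B \<union> R \<and> x < y \<and> relevant_column F z \<longrightarrow> (x, z - 1) \<notin> B \<union> R)"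
      (is "?c B \<longleftrightarrow> ?c (B \<union> R)")
    proof
      assume c: "?c B"
      show "?c (B \<union> R)"
      proof (intro allI impI)
        fix x y z assume *: "(x, z) \<in> B \<union> R \<and> (y, z) \<in> B \<union> R \<and> x < y \<and> relevant_column F z"
        then have D: "(x, z) \<in> L - L'" "(y, z) \<in> L - L'" using BRD by auto
        have yB: "(y, z) \<in> B" using cov[of y z] * D by (auto simp: covered_def)
        show "(x, z - 1) \<notin> B \<union> R"
        proof (cases "x = r")
          case True
          then have "(r, z) \<in> R" using * Br by auto
          then have "z = t" using R_partner[of z y] * D True by auto
          moreover have "t - 1 < t" using skew_pos t_D by fastforce
          ultimately show ?thesis using Br True by (auto simp: R_iff)
        next
          case False
          then have "(x, z) \<in> B" "(x, z - 1) \<notin> R" using * by (auto simp: R_iff)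
          then show ?thesis using c yB * by blast
        qed
      qed
    next
      assume "?c (B \<union> R)"
      then show "?c B" by blast
    qed
    show ?thesis
      unfolding strips_def ribbon_def mem_Collect_eq low_iff con_iff cond_iff
      using free_iff[OF BD] free_iff[OF BRD] cov BD BRD low_iff by auto
  qed
  have toggle_height: "strip_height (B \<union> R) = Suc (strip_height B)"
    if Br: "\<And>w. (r, w) \<notin> B" and B: "B \<in> strips" for B
  proof -
    have "B \<subseteq> L" "B \<noteq> {}"
      using B by (auto simp: strips_def ribbon_def connected_via_def)
    then have fin: "finite (fst ` B)" "fst ` B \<noteq> {}" using finite_L finite_subset by auto
    have "fst ` R = {r}" using t_R by (force simp: R_def)
    then have "fst ` (B \<union> R) = insert r (fst ` B)" by auto
    moreover have "r \<notin> fst ` B" using Br by force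
    \<comment> \<open>Height subtracts 1 in the natural numbers; a strip is nonempty, so nothing is
      truncated.\<close>
    moreover have "0 < card (fst ` B)" using fin by (simp add: card_gt_0_iff)
    ultimately show ?thesis using fin by (simp add: strip_height_def)
  qed
  have toggle: "toggle B \<in> strips \<and> toggle (toggle B) = B \<and>
      (-1) ^ strip_height (toggle B) = - ((-1) ^ strip_height B :: rat)"
    if B: "B \<in> strips" for B
  proof (cases "(r, t) \<in> B")
    case True
    then have eq: "{b \<in> B. fst b = r} = R" using toggle_row[OF B] by auto
    then have BR: "B = (B - R) \<union> R" and no: "\<And>w. (r, w) \<notin> B - R" by auto
    have mem: "B - R \<in> strips" using toggle_strip[OF no] BR B by simp
    have "strip_height B = Suc (strip_height (B - R))" using toggle_height[OF no mem] BR by simp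
    then show ?thesis using True mem BR t_R by (simp add: toggle_def)
  next
    case False
    then have no: "\<And>w. (r, w) \<notin> B" using toggle_row[OF B] t_R by blast
    then have "B \<union> R - R = B" by (auto simp: R_iff)
    then show ?thesis
      using toggle_strip[OF no] toggle_height[OF no B] B False t_R by (simp add: toggle_def)
  qed
  \<comment> \<open>A self-inverse map that flips every sign makes the sum equal to its own
    negative.\<close>
  have "(\<Sum>B \<in> strips. (-1) ^ strip_height B) = (\<Sum>B \<in> strips. - ((-1) ^ strip_height B) :: rat)"
    by (rule sum.reindex_bij_witness[of _ toggle toggle]) (use toggle in auto)
  then show ?thesis by (simp add: sum_negf)
qed

text \<open>The noncommutative Newton identity in the form to be iterated: M separates the
  column-free part \<open>M - L'\<close> from the strip \<open>L - M\<close>. The choice M = L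
  contributes 0, since ribbons are nonempty.\<close>

theorem sum_intermediate:
  "(\<Sum>M \<in> {M. lower_set F \<alpha> M \<and> L' \<subseteq> M \<and> M \<subseteq> L}.
      strip_sign F (L - M) * of_bool (column_free F (M - L'))) =
    of_nat (card (L - L')) * of_bool (column_free F (L - L'))"
  unfolding sum_intermediate_eq_strips
  using strips_column_free strips_not_column_free by (cases "column_free F (L - L')") auto

end

section \<open>Weighted fillings\<close>

definition weak_filling :: "family \<Rightarrow> box set \<Rightarrow> (box \<Rightarrow> nat) \<Rightarrow> bool" where
  "weak_filling F L T \<longleftrightarrow>
     (\<forall>x z w. (x, z) \<in> L \<and> (x, w) \<in> L \<and> z < w \<longrightarrow> T (x, z) \<le> T (x, w)) \<and>
     (\<forall>x y z. (x, z) \<in> L \<and> (y, z) \<in> L \<and> x < y \<and> relevant_column F z \<longrightarrow> T (x, z) \<le> T (y, z))"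

definition fillings :: "family \<Rightarrow> box set \<Rightarrow> nat list \<Rightarrow> (box \<Rightarrow> nat) set" where
  "fillings F L \<beta> = {T \<in> L \<rightarrow>\<^sub>E {1..length \<beta>}. weak_filling F L T \<and>
     (\<forall>i \<in> {1..length \<beta>}. card {b \<in> L. T b = i} = \<beta> ! (i - 1))}"

text \<open>The entries of a filling are weighted through their sets of boxes. With the indicator of
  \<open>column_free\<close> this counts semistandard fillings; with \<open>strip_sign\<close> it is
  the signed count of border strip tableaux.\<close>

definition weighted :: "family \<Rightarrow> (box set \<Rightarrow> rat) \<Rightarrow> box set \<Rightarrow> nat list \<Rightarrow> rat" where
  "weighted F w L \<beta> = (\<Sum>T \<in> fillings F L \<beta>. \<Prod>i = 1..length \<beta>. w {b \<in> L. T b = i})"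

text \<open>This turns a filling into a chain of lower sets.\<close>

lemma lower_set_level:
  assumes L: "lower_set F \<alpha> L" and T: "weak_filling F L T"
  shows "lower_set F \<alpha> {b \<in> L. T b \<le> i}"
  unfolding lower_set_iff
proof (intro conjI allI impI)
  show "{b \<in> L. T b \<le> i} \<subseteq> cd \<alpha>" using lower_set_subset[OF L] by blast
next
  fix x z w assume *: "(x, z) \<in> {b \<in> L. T b \<le> i} \<and> 1 \<le> w \<and> w < z"
  then have "(x, w) \<in> L" using lower_set_row[OF L, of x z w] by simp
  moreover from this have "T (x, w) \<le> T (x, z)" using T * unfolding weak_filling_def by blast
  ultimately show "(x, w) \<in> {b \<in> L. T b \<le> i}" using * by simp
next
  fix x y z assume *: "(x, z) \<in> {b \<in> L. T b \<le> i} \<and> (y, z) \<in> cd \<alpha> \<and> y < x \<and> relevant_column F z"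
  then have "(y, z) \<in> L" using lower_set_column[OF L, of x z y] by simp
  moreover from this have "T (y, z) \<le> T (x, z)" using T * unfolding weak_filling_def by blast
  ultimately show "(y, z) \<in> {b \<in> L. T b \<le> i}" using * by simp
qed

lemma finite_fillings:
  assumes "finite L"
  shows "finite (fillings F L \<beta>)"
  by (rule finite_subset[of _ "L \<rightarrow>\<^sub>E {1..length \<beta>}"])
    (auto simp: fillings_def assms intro!: finite_PiE)

lemma weighted_Nil: "weighted F w L [] = of_bool (L = {})"
proof (cases "L = {}")
  case True
  then have "fillings F L [] = {\<lambda>_. undefined}"
    by (auto simp: fillings_def weak_filling_def)
  then show ?thesis using True by (simp add: weighted_def)
next
  case False
  then obtain b where "b \<in> L" by blast
  then have "L \<rightarrow>\<^sub>E {1..length ([] :: nat list)} = {}"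
    unfolding PiE_eq_empty_iff by (intro bexI[of _ b]) simp_all
  then have "fillings F L [] = {}" unfolding fillings_def by blast
  then show ?thesis using False by (simp add: weighted_def)
qed

text \<open>M collects the boxes whose entry is at most the length of \<beta>; the boxes of
  \<open>L - M\<close> all carry the one new largest entry. Restriction to M and extension by that
  entry are mutually inverse.\<close>

lemma weighted_snoc:
  assumes L: "lower_set F \<alpha> L"
  shows "weighted F w L (\<beta> @ [k]) =
    (\<Sum>M \<in> {M. lower_set F \<alpha> M \<and> M \<subseteq> L \<and> card (L - M) = k}. w (L - M) * weighted F w M \<beta>)"
proof -
  let ?l = "length \<beta>"
  let ?A = "{M. lower_set F \<alpha> M \<and> M \<subseteq> L \<and> card (L - M) = k}"
  define ext where "ext M T = (\<lambda>b. if b \<in> M then T b else if b \<in> L then Suc ?l else undefined)"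
    for M and T :: "box \<Rightarrow> nat"
  have finL: "finite L" using lower_set_subset[OF L] finite_subset[OF _ finite_cd] by blast
  have level_ext: "{b \<in> L. ext M T b = i} = (if i = Suc ?l then L - M else {b \<in> M. T b = i})"
    if M: "M \<subseteq> L" and T: "T \<in> M \<rightarrow>\<^sub>E {1..?l}" for M T i
  proof (rule set_eqI)
    fix b
    show "b \<in> {b \<in> L. ext M T b = i} \<longleftrightarrow> b \<in> (if i = Suc ?l then L - M else {b \<in> M. T b = i})"
    proof (cases "b \<in> M")
      case True
      then have "T b \<le> ?l" using T by (simp add: PiE_iff)
      then show ?thesis using True M by (auto simp: ext_def)
    qed (auto simp: ext_def)
  qed
  have restr: "({b \<in> L. T b \<le> ?l}, restrict T {b \<in> L. T b \<le> ?l}) \<in> Sigma ?A (\<lambda>M. fillings F M \<beta>)"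
    if T: "T \<in> fillings F L (\<beta> @ [k])" for T
  proof -
    let ?M = "{b \<in> L. T b \<le> ?l}"
    have T': "T \<in> L \<rightarrow>\<^sub>E {1..Suc ?l}" "weak_filling F L T"
      and card: "\<And>i. i \<in> {1..Suc ?l} \<Longrightarrow> card {b \<in> L. T b = i} = (\<beta> @ [k]) ! (i - 1)"
      using T by (auto simp: fillings_def)
    have range: "1 \<le> T b \<and> T b \<le> Suc ?l" if "b \<in> L" for b
      using T'(1) that by (auto simp: PiE_iff)
    have "L - ?M = {b \<in> L. T b = Suc ?l}" using range by (force simp: not_le)
    then have "card (L - ?M) = k" using card[of "Suc ?l"] by simp
    moreover have "restrict T ?M \<in> ?M \<rightarrow>\<^sub>E {1..?l}" using range by auto
    moreover have "weak_filling F ?M (restrict T ?M)"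
      using T'(2) unfolding weak_filling_def by simp
    moreover have "card {b \<in> ?M. restrict T ?M b = i} = \<beta> ! (i - 1)" if "i \<in> {1..?l}" for i
    proof -
      have "{b \<in> ?M. restrict T ?M b = i} = {b \<in> L. T b = i}" using that by auto
      then show ?thesis using card[of i] that by (auto simp: nth_append)
    qed
    ultimately show ?thesis
      using lower_set_level[OF L T'(2), of ?l] by (simp add: fillings_def)
  qed
  have ext_restr: "ext {b \<in> L. T b \<le> ?l} (restrict T {b \<in> L. T b \<le> ?l}) = T"
    if T: "T \<in> fillings F L (\<beta> @ [k])" for T
  proof
    fix b
    have TL: "T \<in> L \<rightarrow>\<^sub>E {1..Suc ?l}" using T by (simp add: fillings_def)
    show "ext {b \<in> L. T b \<le> ?l} (restrict T {b \<in> L. T b \<le> ?l}) b = T b"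
    proof (cases "b \<in> L")
      case True
      then show ?thesis using PiE_mem[OF TL True] by (auto simp: ext_def)
    next
      case False
      then show ?thesis using PiE_arb[OF TL False] by (auto simp: ext_def)
    qed
  qed
  have ext_mem: "ext M T \<in> fillings F L (\<beta> @ [k])"
    and restr_ext: "({b \<in> L. ext M T b \<le> ?l}, restrict (ext M T) {b \<in> L. ext M T b \<le> ?l}) = (M, T)"
    and weight_ext: "(\<Prod>i = 1..Suc ?l. w {b \<in> L. ext M T b = i}) =
      w (L - M) * (\<Prod>i = 1..?l. w {b \<in> M. T b = i})"
    if M: "M \<in> ?A" and T: "T \<in> fillings F M \<beta>" for M T
  proof -
    have M': "lower_set F \<alpha> M" "M \<subseteq> L" "card (L - M) = k" using M by auto
    have T': "T \<in> M \<rightarrow>\<^sub>E {1..?l}" "weak_filling F M T" using T by (auto simp: fillings_def)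
    have range: "1 \<le> T b \<and> T b \<le> ?l" if "b \<in> M" for b
      using T'(1) that by (auto simp: PiE_iff)
    \<comment> \<open>The new entry is the largest, so a comparison matters only when the later box
      lies in M; that M is a lower set then puts the earlier box there too.\<close>
    have mono: "ext M T b \<le> ext M T c" if "b \<in> L" "c \<in> L" "c \<in> M \<Longrightarrow> b \<in> M \<and> T b \<le> T c" for b c
      using that range[of b] by (auto simp: ext_def)
    have "weak_filling F L (ext M T)"
      unfolding weak_filling_def
    proof (intro conjI allI impI)
      fix x z v assume *: "(x, z) \<in> L \<and> (x, v) \<in> L \<and> z < v"
      have "(x, z) \<in> cd \<alpha>" using * lower_set_subset[OF L] by blast
      then have "1 \<le> z" by (rule cd_pos)
      then show "ext M T (x, z) \<le> ext M T (x, v)"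
        using * lower_set_row[OF M'(1), of x v z] T'(2)
        by (intro mono) (auto simp: weak_filling_def)
    next
      fix x y z assume *: "(x, z) \<in> L \<and> (y, z) \<in> L \<and> x < y \<and> relevant_column F z"
      then have "(x, z) \<in> cd \<alpha>" using lower_set_subset[OF L] by blast
      then show "ext M T (x, z) \<le> ext M T (y, z)"
        using * lower_set_column[OF M'(1), of y z x] T'(2)
        by (intro mono) (auto simp: weak_filling_def)
    qed
    moreover have "ext M T \<in> L \<rightarrow>\<^sub>E {1..length (\<beta> @ [k])}"
    proof (rule PiE_I)
      fix b assume "b \<in> L"
      then show "ext M T b \<in> {1..length (\<beta> @ [k])}"
        using range[of b] by (auto simp: ext_def)
    qed (use M'(2) in \<open>auto simp: ext_def\<close>)
    moreover have "card {b \<in> L. ext M T b = i} = (\<beta> @ [k]) ! (i - 1)" if "i \<in> {1..Suc ?l}" for i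
      using that M' T unfolding level_ext[OF M'(2) T'(1)] by (auto simp: fillings_def nth_append)
    ultimately show "ext M T \<in> fillings F L (\<beta> @ [k])" by (simp add: fillings_def)
    have eq: "{b \<in> L. ext M T b \<le> ?l} = M"
    proof (rule set_eqI)
      fix b show "b \<in> {b \<in> L. ext M T b \<le> ?l} \<longleftrightarrow> b \<in> M"
        using M'(2) range[of b] by (auto simp: ext_def)
    qed
    have "restrict (ext M T) M = restrict T M"
      by (rule restrict_ext) (simp add: ext_def)
    then have "restrict (ext M T) M = T"
      using PiE_restrict[OF T'(1)] by simp
    then show "({b \<in> L. ext M T b \<le> ?l}, restrict (ext M T) {b \<in> L. ext M T b \<le> ?l}) = (M, T)"
      unfolding eq by simp
    show "(\<Prod>i = 1..Suc ?l. w {b \<in> L. ext M T b = i}) =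
      w (L - M) * (\<Prod>i = 1..?l. w {b \<in> M. T b = i})"
      unfolding level_ext[OF M'(2) T'(1)] by (simp add: mult.commute)
  qed
  have finA: "finite ?A" by (rule finite_lower_sets)
  have finM: "\<forall>M \<in> ?A. finite (fillings F M \<beta>)"
    using finL finite_subset finite_fillings by blast
  have "(\<Sum>M \<in> ?A. w (L - M) * weighted F w M \<beta>) =
      (\<Sum>M \<in> ?A. \<Sum>T \<in> fillings F M \<beta>. w (L - M) * (\<Prod>i = 1..?l. w {b \<in> M. T b = i}))"
    by (simp add: weighted_def sum_distrib_left)
  also have "\<dots> = (\<Sum>(M, T) \<in> Sigma ?A (\<lambda>M. fillings F M \<beta>).
      w (L - M) * (\<Prod>i = 1..?l. w {b \<in> M. T b = i}))"
    by (rule sum.Sigma[OF finA finM])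
  also have "\<dots> = weighted F w L (\<beta> @ [k])"
    unfolding weighted_def
  proof (rule sum.reindex_bij_witness[where j = "\<lambda>(M, T). ext M T"
        and i = "\<lambda>T. ({b \<in> L. T b \<le> ?l}, restrict T {b \<in> L. T b \<le> ?l})"])
    fix p assume p: "p \<in> Sigma ?A (\<lambda>M. fillings F M \<beta>)"
    obtain M T where MT: "p = (M, T)" by (cases p)
    have M: "M \<in> ?A" "T \<in> fillings F M \<beta>" using p MT by auto
    show "({b \<in> L. (case p of (M, T) \<Rightarrow> ext M T) b \<le> ?l},
        restrict (case p of (M, T) \<Rightarrow> ext M T) {b \<in> L. (case p of (M, T) \<Rightarrow> ext M T) b \<le> ?l}) = p"
      unfolding MT prod.case by (rule restr_ext[OF M])
    show "(case p of (M, T) \<Rightarrow> ext M T) \<in> fillings F L (\<beta> @ [k])"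
      unfolding MT prod.case by (rule ext_mem[OF M])
    show "(\<Prod>i = 1..length (\<beta> @ [k]). w {b \<in> L. (case p of (M, T) \<Rightarrow> ext M T) b = i}) =
        (case p of (M, T) \<Rightarrow> w (L - M) * (\<Prod>i = 1..?l. w {b \<in> M. T b = i}))"
      unfolding MT prod.case using weight_ext[OF M] by (simp only: length_append_singleton)
  next
    fix T assume T: "T \<in> fillings F L (\<beta> @ [k])"
    show "({b \<in> L. T b \<le> ?l}, restrict T {b \<in> L. T b \<le> ?l}) \<in> Sigma ?A (\<lambda>M. fillings F M \<beta>)"
      by (rule restr[OF T])
    show "(case ({b \<in> L. T b \<le> ?l}, restrict T {b \<in> L. T b \<le> ?l}) of (M, T) \<Rightarrow> ext M T) = T"
      unfolding prod.case by (rule ext_restr[OF T])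
  qed
  finally show ?thesis by simp
qed

text \<open>The counterpart of h_k = \<Sum> p_\<delta> / \<pi>(\<delta>), with \<beta> filling the
  boxes below. The last part j of \<delta> is the size of the topmost strip and the last factor of
  \<open>pi_comp\<close> is k. Induction handles the other k - j boxes, and the Newton identity over
  the lower sets N below the strip returns a factor k that cancels.\<close>

lemma sum_compositions_weighted:
  assumes "lower_set F \<alpha> L"
  shows "(\<Sum>\<delta> \<in> compositions k. weighted F (strip_sign F) L (\<beta> @ \<delta>) / of_nat (pi_comp \<delta>)) =
    (\<Sum>M \<in> {M. lower_set F \<alpha> M \<and> M \<subseteq> L \<and> card (L - M) = k}.
      of_bool (column_free F (L - M)) * weighted F (strip_sign F) M \<beta>)"
  using assms
proof (induction k arbitrary: L rule: less_induct)
  case (less k)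
  let ?Z = "weighted F (strip_sign F)"
  let ?B = "{M. lower_set F \<alpha> M \<and> M \<subseteq> L \<and> card (L - M) = k}"
  have fin: "finite M" if "M \<subseteq> L" for M
    using that lower_set_subset[OF less.prems] finite_subset[OF _ finite_cd] by blast
  show ?case
  proof (cases "k = 0")
    case True
    have "?B = {L}"
      using fin True less.prems by auto
    then show ?thesis using True by (simp add: pi_comp_def column_free_def)
  next
    case False
    let ?S = "{N. lower_set F \<alpha> N \<and> N \<subseteq> L \<and> card (L - N) \<in> {1..k}}"
    let ?g = "\<lambda>N M. strip_sign F (L - N) * (of_bool (column_free F (N - M)) * ?Z M \<beta>)"
    have finS: "finite ?S" "finite ?B" by (rule finite_lower_sets)+
    have step: "(\<Sum>\<delta> \<in> compositions (k - j). ?Z L (\<beta> @ \<delta> @ [j]) / of_nat (pi_comp (\<delta> @ [j]))) =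
        (\<Sum>N \<in> {N \<in> ?S. card (L - N) = j}. \<Sum>M \<in> {M \<in> ?B. M \<subseteq> N}. ?g N M) / of_nat k"
      if j: "j \<in> {1..k}" for j
    proof -
      let ?N = "{N. lower_set F \<alpha> N \<and> N \<subseteq> L \<and> card (L - N) = j}"
      have S_eq: "{N \<in> ?S. card (L - N) = j} = ?N" using j by auto
      have "(\<Sum>\<delta> \<in> compositions (k - j). ?Z L (\<beta> @ \<delta> @ [j]) / of_nat (pi_comp (\<delta> @ [j]))) =
          (\<Sum>\<delta> \<in> compositions (k - j).
            (\<Sum>N \<in> ?N. strip_sign F (L - N) * (?Z N (\<beta> @ \<delta>) / of_nat (pi_comp \<delta>))) / of_nat k)"
      proof (rule sum.cong[OF refl])
        fix \<delta> assume "\<delta> \<in> compositions (k - j)"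
        then have "pi_comp (\<delta> @ [j]) = pi_comp \<delta> * k"
          using j by (simp add: compositions_iff pi_comp_snoc)
        then show "?Z L (\<beta> @ \<delta> @ [j]) / of_nat (pi_comp (\<delta> @ [j])) =
            (\<Sum>N \<in> ?N. strip_sign F (L - N) * (?Z N (\<beta> @ \<delta>) / of_nat (pi_comp \<delta>))) / of_nat k"
          using weighted_snoc[OF less.prems, of "strip_sign F" "\<beta> @ \<delta>" j]
          by (simp add: sum_divide_distrib)
      qed
      also have "\<dots> = (\<Sum>N \<in> ?N. strip_sign F (L - N) *
          (\<Sum>\<delta> \<in> compositions (k - j). ?Z N (\<beta> @ \<delta>) / of_nat (pi_comp \<delta>))) / of_nat k"
        unfolding sum_divide_distrib[symmetric] sum_distrib_left by (subst sum.swap) simp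
      also have "\<dots> = (\<Sum>N \<in> ?N. \<Sum>M \<in> {M \<in> ?B. M \<subseteq> N}. ?g N M) / of_nat k"
      proof (intro arg_cong[of _ _ "\<lambda>q. q / of_nat k"] sum.cong refl)
        fix N assume N: "N \<in> ?N"
        have card_split: "card (L - M) = card (L - N) + card (N - M)" if "M \<subseteq> N" for M
        proof -
          have "L - M = (L - N) \<union> (N - M)" "(L - N) \<inter> (N - M) = {}" using that N by auto
          moreover have "finite (L - N)" "finite (N - M)" using N by (auto intro!: fin)
          ultimately show ?thesis by (simp only: card_Un_disjoint)
        qed
        \<comment> \<open>Sizes of differences add up, so the admissible M form a set that depends
          on j only through N. This permits exchanging the two summations later.\<close>
        have set_eq: "{M. lower_set F \<alpha> M \<and> M \<subseteq> N \<and> card (N - M) = k - j} = {M \<in> ?B. M \<subseteq> N}"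
        proof (rule set_eqI)
          fix M
          have "M \<subseteq> N \<Longrightarrow> M \<subseteq> L \<and> (card (N - M) = k - j \<longleftrightarrow> card (L - M) = k)"
            using card_split[of M] N j by force
          then show "M \<in> {M. lower_set F \<alpha> M \<and> M \<subseteq> N \<and> card (N - M) = k - j} \<longleftrightarrow> M \<in> {M \<in> ?B. M \<subseteq> N}"
            by blast
        qed
        have "k - j < k" "lower_set F \<alpha> N" using j N by auto
        then show "strip_sign F (L - N) * (\<Sum>\<delta> \<in> compositions (k - j). ?Z N (\<beta> @ \<delta>) / of_nat (pi_comp \<delta>)) =
            (\<Sum>M \<in> {M \<in> ?B. M \<subseteq> N}. ?g N M)"
          by (simp only: less.IH set_eq sum_distrib_left)
      qed
      finally show ?thesis unfolding S_eq .
    qed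
    have "(\<Sum>\<delta> \<in> compositions k. ?Z L (\<beta> @ \<delta>) / of_nat (pi_comp \<delta>)) =
        (\<Sum>j = 1..k. (\<Sum>N \<in> {N \<in> ?S. card (L - N) = j}. \<Sum>M \<in> {M \<in> ?B. M \<subseteq> N}. ?g N M) / of_nat k)"
    proof (subst sum_compositions_snoc)
      show "0 < k" using False by simp
    qed (rule sum.cong[OF refl step])
    also have "\<dots> = (\<Sum>j = 1..k. \<Sum>N \<in> {N \<in> ?S. card (L - N) = j}. \<Sum>M \<in> {M \<in> ?B. M \<subseteq> N}. ?g N M) / of_nat k"
      by (simp only: sum_divide_distrib)
    \<comment> \<open>The index j is just the size of \<open>L - N\<close>, so summing over j and
      over N of that size is summing over all N in \<open>?S\<close>.\<close>
    also have "\<dots> = (\<Sum>N \<in> ?S. \<Sum>M \<in> {M \<in> ?B. M \<subseteq> N}. ?g N M) / of_nat k"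
      by (subst sum.group[OF finS(1)]) (simp, blast, rule refl)
    also have "\<dots> = (\<Sum>M \<in> ?B. \<Sum>N \<in> {N \<in> ?S. M \<subseteq> N}. ?g N M) / of_nat k"
      by (subst sum.swap_restrict[OF finS]) (rule refl)
    also have "\<dots> = (\<Sum>M \<in> ?B. of_nat k * (of_bool (column_free F (L - M)) * ?Z M \<beta>)) / of_nat k"
    proof (intro arg_cong[of _ _ "\<lambda>q. q / of_nat k"] sum.cong refl)
      fix M assume M: "M \<in> ?B"
      interpret nested_lower_sets F \<alpha> L M
        by unfold_locales (use M less.prems in auto)
      let ?I = "{N. lower_set F \<alpha> N \<and> M \<subseteq> N \<and> N \<subseteq> L}"
      \<comment> \<open>The only lower set between M and L that \<open>?S\<close> leaves out is L
        itself; its strip would be empty and has sign 0.\<close>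
      have "(\<Sum>N \<in> {N \<in> ?S. M \<subseteq> N}. ?g N M) = (\<Sum>N \<in> ?I. ?g N M)"
      proof (rule sum.mono_neutral_left)
        show "\<forall>N \<in> ?I - {N \<in> ?S. M \<subseteq> N}. ?g N M = 0"
        proof
          fix N assume N: "N \<in> ?I - {N \<in> ?S. M \<subseteq> N}"
          have "card (L - N) \<le> card (L - M)" using N fin by (intro card_mono) auto
          then have "card (L - N) = 0" using N M by auto
          then have "L - N = {}" using fin by auto
          then show "?g N M = 0"
            by (simp add: strip_sign_def ribbon_def connected_via_def)
        qed
      qed auto
      also have "\<dots> = (\<Sum>N \<in> ?I. strip_sign F (L - N) * of_bool (column_free F (N - M))) * ?Z M \<beta>"
        by (simp only: sum_distrib_right mult.assoc)
      also have "\<dots> = of_nat k * (of_bool (column_free F (L - M)) * ?Z M \<beta>)"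
        using M by (simp only: sum_intermediate mem_Collect_eq mult.assoc)
      finally show "(\<Sum>N \<in> {N \<in> ?S. M \<subseteq> N}. ?g N M) =
        of_nat k * (of_bool (column_free F (L - M)) * ?Z M \<beta>)" .
    qed
    also have "\<dots> = (\<Sum>M \<in> ?B. of_bool (column_free F (L - M)) * ?Z M \<beta>)"
      unfolding sum_distrib_left[symmetric] using False by simp
    finally show ?thesis .
  qed
qed

text \<open>A refinement of \<gamma> followed by k is a refinement of \<gamma> followed by a
  composition of k, and the weight \<pi> factors accordingly. The inner sum over compositions of k
  replaces the strips by one column-free layer of k boxes.\<close>

theorem weighted_column_free:
  assumes "positive \<gamma>" "lower_set F \<alpha> L"
  shows "weighted F (\<lambda>B. of_bool (column_free F B)) L \<gamma> =
    (\<Sum>\<beta> \<in> refinements \<gamma>. weighted F (strip_sign F) L \<beta> / of_nat (pi_coarse \<beta> \<gamma>))"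
  using assms
proof (induction \<gamma> arbitrary: L rule: rev_induct)
  case Nil
  then show ?case by (simp add: weighted_Nil pi_coarse_def)
next
  case (snoc k \<gamma>)
  let ?B = "{M. lower_set F \<alpha> M \<and> M \<subseteq> L \<and> card (L - M) = k}"
  let ?c = "\<lambda>B. of_bool (column_free F B) :: rat" and ?Z = "weighted F (strip_sign F)"
  have pos: "positive \<gamma>" using snoc.prems by simp
  have "(\<Sum>\<beta> \<in> refinements (\<gamma> @ [k]). ?Z L \<beta> / of_nat (pi_coarse \<beta> (\<gamma> @ [k]))) =
      (\<Sum>\<beta> \<in> refinements \<gamma>. \<Sum>\<delta> \<in> compositions k.
        ?Z L (\<beta> @ \<delta>) / of_nat (pi_coarse (\<beta> @ \<delta>) (\<gamma> @ [k])))"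
    by (rule sum_refinements_snoc[OF snoc.prems(1)])
  also have "\<dots> = (\<Sum>\<beta> \<in> refinements \<gamma>.
      (\<Sum>\<delta> \<in> compositions k. ?Z L (\<beta> @ \<delta>) / of_nat (pi_comp \<delta>)) / of_nat (pi_coarse \<beta> \<gamma>))"
    unfolding sum_divide_distrib
    by (intro sum.cong refl) (simp add: pi_coarse_snoc refinements_iff[OF pos] compositions_iff mult.commute)
  also have "\<dots> = (\<Sum>\<beta> \<in> refinements \<gamma>. \<Sum>M \<in> ?B. ?c (L - M) * (?Z M \<beta> / of_nat (pi_coarse \<beta> \<gamma>)))"
    unfolding sum_compositions_weighted[OF snoc.prems(2)]
    by (simp only: sum_divide_distrib times_divide_eq_right)
  also have "\<dots> = (\<Sum>M \<in> ?B. ?c (L - M) * (\<Sum>\<beta> \<in> refinements \<gamma>. ?Z M \<beta> / of_nat (pi_coarse \<beta> \<gamma>)))"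
    by (subst sum.swap) (simp add: sum_distrib_left)
  also have "\<dots> = (\<Sum>M \<in> ?B. ?c (L - M) * weighted F ?c M \<gamma>)"
    by (intro sum.cong refl) (use snoc.IH pos in simp)
  also have "\<dots> = weighted F ?c L (\<gamma> @ [k])"
    by (rule weighted_snoc[OF snoc.prems(2), symmetric])
  finally show ?case by simp
qed

section \<open>Border strip tableaux as weighted fillings\<close>

lemma connected_via_mono:
  assumes "connected_via A B" "\<And>b c. b \<in> B \<Longrightarrow> c \<in> B \<Longrightarrow> (b, c) \<in> A \<Longrightarrow> (b, c) \<in> A'"
  shows "connected_via A' B"
proof -
  have "A \<inter> B \<times> B \<subseteq> A' \<inter> B \<times> B" using assms(2) by blast
  then have "(A \<inter> B \<times> B)\<^sup>* \<subseteq> (A' \<inter> B \<times> B)\<^sup>*" by (rule rtrancl_mono)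
  then show ?thesis using assms(1) unfolding connected_via_def by blast
qed

lemma lower_set_Int: "lower_set F \<alpha> L \<Longrightarrow> lower_set F \<alpha> L' \<Longrightarrow> lower_set F \<alpha> (L \<inter> L')"
  unfolding lower_set_iff by blast

text \<open>Skew diagrams are convex in rows and in relevant columns. For
  \<open>Extended_Schur\<close>, no box of the diagram outside B therefore lies between two boxes of
  B in a column, so these are always adjacent. For \<open>Dual_Immaculate\<close>, different rows
  communicate only through column 1, which has no gaps, so a link there is realized by vertical unit
  steps.\<close>

lemma border_strip_iff_ribbon:
  assumes pos: "positive \<alpha>" and skew: "skew_diagram F \<alpha> B"
  shows "border_strip F \<alpha> B \<longleftrightarrow> ribbon F B"
proof -
  obtain L K where LK: "lower_set F \<alpha> L" "lower_set F \<alpha> K" "B = L - K"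
    using skew unfolding skew_diagram_def by blast
  \<comment> \<open>The difference is unchanged by this intersection, which makes the two lower sets
    nested.\<close>
  define L' where "L' = L \<inter> K"
  have B: "B = L - L'" using LK by (auto simp: L'_def)
  interpret nested_lower_sets F \<alpha> L L'
    by unfold_locales (use LK lower_set_Int in \<open>auto simp: L'_def\<close>)
  have B_cd: "B \<subseteq> cd \<alpha>" using in_cd B by blast
  have row: "(x, v) \<in> B" if "(x, z) \<in> B" "(x, w) \<in> B" "z \<le> v" "v \<le> w" for x z v w
    using skew_row_between[of x z w v] that unfolding B by blast
  have column: "(u, z) \<in> B"
    if "(x, z) \<in> B" "(y, z) \<in> B" "x \<le> u" "u \<le> y" "relevant_column F z" "(u, z) \<in> cd \<alpha>" for x y u z
    using column_below(1)[of y z u] skew_column[of x z u] that unfolding B by blast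
  show ?thesis
  proof (cases F)
    case Extended_Schur
    have eq: "(b, c) \<in> edge_adjacent \<union> column_adjacent \<alpha> B \<longleftrightarrow> (b, c) \<in> link F"
      if bc: "b \<in> B" "c \<in> B" for b c
    proof -
      obtain x z y w where xy: "b = (x, z)" "c = (y, w)" by (cases b, cases c)
      have "(u, z) \<notin> cd \<alpha> - B" if "w = z" "min x y < u \<and> u < max x y" for u
        using column[of x z y u] column[of y z x u] bc that
        unfolding xy Extended_Schur by (cases "x \<le> y") auto
      then show ?thesis
        unfolding xy by (auto simp: Extended_Schur link_def edge_adjacent_def column_adjacent_def)
    qed
    have "connected_via (edge_adjacent \<union> column_adjacent \<alpha> B) B \<longleftrightarrow> connected_via (link F) B"
      using eq connected_via_mono[of "edge_adjacent \<union> column_adjacent \<alpha> B" B "link F"]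
        connected_via_mono[of "link F" B "edge_adjacent \<union> column_adjacent \<alpha> B"] by blast
    then show ?thesis
      using skew by (simp add: Extended_Schur border_strip_extended_schur_def ribbon_def)
  next
    case Dual_Immaculate
    have not_0: "(x, 0) \<notin> B" for x using B_cd cd_pos[of x 0 \<alpha>] by auto
    have rib: "ribbon F B \<longleftrightarrow> connected_via (link F) B"
      using not_0 by (auto simp: ribbon_def Dual_Immaculate)
    \<comment> \<open>Positive parts mean that every row has a box in column 1, so the first column
      is an unbroken interval of rows.\<close>
    have first: "(x, 1) \<in> cd \<alpha>" if "(y, w) \<in> B" "(y', w') \<in> B" "y \<le> x" "x \<le> y'" for x y w y' w'
    proof -
      have "(y, w) \<in> cd \<alpha>" "(y', w') \<in> cd \<alpha>" using that B_cd by auto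
      then have "1 \<le> x" "x \<le> length \<alpha>" using that by (auto simp: cd_def)
      then show ?thesis using pos by (auto simp: cd_def positive_def)
    qed
    have strip: "connected_via edge_adjacent B \<and>
        (horizontal_strip B \<or>
         (\<exists>\<S>. (\<forall>S \<in> \<S>. horizontal_strip S \<and> (\<exists>x. (x, 1) \<in> S)) \<and> B = \<Union>\<S>)) \<longleftrightarrow>
        connected_via (link F) B"
      (is "?con \<and> (_ \<or> ?union) \<longleftrightarrow> ?link")
    proof
      assume l: "?con \<and> (horizontal_strip B \<or> ?union)"
      then consider "horizontal_strip B" | \<S> where
        "\<And>S. S \<in> \<S> \<Longrightarrow> horizontal_strip S \<and> (\<exists>x. (x, 1) \<in> S)" "B = \<Union>\<S>"
        by blast
      then show ?link
      proof cases
        case 1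
        then obtain x p q where "B = {x} \<times> {p..q}" by (auto simp: horizontal_strip_def)
        then show ?thesis
          using connected_via_mono[OF conjunct1[OF l], of "link F"]
          by (auto simp: edge_adjacent_def link_def)
      next
        case 2
        \<comment> \<open>The horizontal strip of the family through \<open>(x, z)\<close> lies in
          row x and reaches column 1, hence contains everything in between.\<close>
        have start: "(x, v) \<in> B" if xz: "(x, z) \<in> B" "1 \<le> v" "v \<le> z" for x z v
        proof -
          obtain S where S: "S \<in> \<S>" "(x, z) \<in> S" using xz 2(2) by blast
          then obtain x' p q y where "S = {x'} \<times> {p..q}" "(y, 1) \<in> S"
            using 2(1)[of S] unfolding horizontal_strip_def by blast
          then have "(x, v) \<in> S" using S xz by auto
          then show ?thesis using S 2(2) by blast
        qed
        show ?thesis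
          unfolding connected_via_iff
        proof (intro conjI allI impI)
          show "B \<noteq> {}" using l by (simp add: connected_via_def)
          fix S assume S: "S \<subseteq> B \<and> S \<noteq> {} \<and> (\<forall>b \<in> S. \<forall>c \<in> B. (b, c) \<in> link F \<longrightarrow> c \<in> S)"
          have pos_col: "1 \<le> z" if "(x, z) \<in> B" for x z
            using that B_cd cd_pos by blast
          have seg: "(x, v) \<in> S" if "(x, u) \<in> S" "(x, z) \<in> B" "1 \<le> u" "u \<le> z" "1 \<le> v" "v \<le> z" for x u v z
            by (rule row_segment_closed[where p = 1 and q = z and B = B and F = F and u = u])
              (use S start[of x z] that in auto)
          obtain x z where xz: "(x, z) \<in> S" using S by (metis ex_in_conv surj_pair)
          have "(x, 1) \<in> S"
            using seg[of x z z 1] xz S pos_col[of x z] by auto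
          have "(y, w) \<in> S" if yw: "(y, w) \<in> B" for y w
          proof -
            have "(y, 1) \<in> B" using start[OF yw, of 1] pos_col[OF yw] by simp
            then have "(y, 1) \<in> S"
              using S \<open>(x, 1) \<in> S\<close> by (auto simp: link_def)
            then show ?thesis using seg[of y 1 w w] yw pos_col[OF yw] by simp
          qed
          then show "S = B" using S by auto
        qed
      qed
    next
      assume con: ?link
      then have ne: "B \<noteq> {}" by (simp add: connected_via_def)
      show "?con \<and> (horizontal_strip B \<or> ?union)"
      proof (cases "\<exists>x. (x, 1) \<in> B")
        case True
        then obtain x0 where x0: "(x0, 1) \<in> B" by blast
        \<comment> \<open>Links either stay in a row or stay in column 1, so having a box of one's
          row in column 1 is inherited along links.\<close>
        have all: "{b \<in> B. (fst b, 1) \<in> B} = B"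
        proof (rule con[unfolded connected_via_iff, THEN conjunct2, rule_format], intro conjI ballI impI)
          fix b c assume "b \<in> {b \<in> B. (fst b, 1) \<in> B}" "c \<in> B" "(b, c) \<in> link F"
          then show "c \<in> {b \<in> B. (fst b, 1) \<in> B}"
            by (cases b, cases c) (auto simp: link_def Dual_Immaculate)
        qed (use x0 in auto)
        have start: "(x, v) \<in> B" if "(x, z) \<in> B" "1 \<le> v" "v \<le> z" for x z v
        proof -
          have "(x, z) \<in> {b \<in> B. (fst b, 1) \<in> B}" using that(1) unfolding all .
          then have "(x, 1) \<in> B" by simp
          then show ?thesis using row[of x 1 z v] that by simp
        qed
        let ?S = "(\<lambda>(x, z). {x} \<times> {1..z}) ` B"
        have ?union
        proof (intro exI[of _ ?S] conjI ballI)
          show "B = \<Union>?S"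
            using start B_cd cd_pos by fastforce
          fix S assume "S \<in> ?S"
          then obtain x z where S: "S = {x} \<times> {1..z}" "(x, z) \<in> B" by auto
          have "1 \<le> z" using S B_cd cd_pos by blast
          then show "horizontal_strip S" "\<exists>x. (x, 1) \<in> S"
            unfolding horizontal_strip_def S(1) by auto
        qed
        moreover have ?con
          unfolding connected_via_iff
        proof (intro conjI allI impI ne)
          fix S assume S: "S \<subseteq> B \<and> S \<noteq> {} \<and> (\<forall>b \<in> S. \<forall>c \<in> B. (b, c) \<in> edge_adjacent \<longrightarrow> c \<in> S)"
          have pos_col: "1 \<le> z" if "(x, z) \<in> B" for x z
            using that B_cd cd_pos by blast
          have seg: "(x, v) \<in> S" if "(x, u) \<in> S" "(x, z) \<in> B" "1 \<le> u" "u \<le> z" "1 \<le> v" "v \<le> z" for x u v z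
            by (rule segment_closed[where g = "\<lambda>v. (x, v)" and p = 1 and q = z and B = B
                  and A = edge_adjacent and u = u])
              (use S start[of x z] that in \<open>auto simp: edge_adjacent_def\<close>)
          have vert: "(y, 1) \<in> S" if xy: "(x, 1) \<in> S" "(y, 1) \<in> B" for x y
          proof (rule segment_closed[where g = "\<lambda>u. (u, 1)" and p = "min x y" and q = "max x y" and B = B
                and A = edge_adjacent and u = x])
            have xB: "(x, 1) \<in> B" using S xy by blast
            fix u assume u: "min x y \<le> u" "u \<le> max x y"
            show "(u, 1) \<in> B"
            proof (cases "x \<le> y")
              case True
              then have "x \<le> u" "u \<le> y" using u by auto
              then show ?thesis
                using column[OF xB xy(2) _ _ _ first[OF xB xy(2)]] by (simp add: Dual_Immaculate)
            next
              case False
              then have "y \<le> u" "u \<le> x" using u by auto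
              then show ?thesis
                using column[OF xy(2) xB _ _ _ first[OF xy(2) xB]] by (simp add: Dual_Immaculate)
            qed
          next
            fix b c assume "b \<in> S" "c \<in> B" "(b, c) \<in> edge_adjacent"
            then show "c \<in> S" using S by blast
          qed (use xy in \<open>simp_all add: edge_adjacent_def\<close>)
          obtain x z where xz: "(x, z) \<in> S" using S by (metis ex_in_conv surj_pair)
          have "(x, 1) \<in> S"
            using seg[of x z z 1] xz S pos_col[of x z] by auto
          have "(y, w) \<in> S" if yw: "(y, w) \<in> B" for y w
            using seg[of y 1 w w] vert[OF \<open>(x, 1) \<in> S\<close>, of y] yw pos_col[OF yw] start[OF yw, of 1] by simp
          then show "S = B" using S by auto
        qed
        ultimately show ?thesis by blast
      next
        case False
        obtain x u where xu: "(x, u) \<in> B" using ne by fastforce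
        \<comment> \<open>Without a box in column 1 only horizontal links remain; convexity of rows
          then makes B an interval of row x.\<close>
        have one_row: "{b \<in> B. fst b = x} = B"
        proof (rule con[unfolded connected_via_iff, THEN conjunct2, rule_format], intro conjI ballI impI)
          fix b c assume "b \<in> {b \<in> B. fst b = x}" "c \<in> B" "(b, c) \<in> link F"
          then show "c \<in> {b \<in> B. fst b = x}"
            using False by (cases b, cases c) (auto simp: link_def Dual_Immaculate)
        qed (use xu in auto)
        have fst_eq: "fst b = x" if "b \<in> B" for b
          using that one_row by blast
        have fin: "finite (snd ` B)" using B_cd finite_subset[OF _ finite_cd] by blast
        define p q where "p = Min (snd ` B)" and "q = Max (snd ` B)"
        have "p \<in> snd ` B" "q \<in> snd ` B"
          unfolding p_def q_def using fin ne by auto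
        then obtain y y' where "(y, p) \<in> B" "(y', q) \<in> B" by auto
        then have ends: "(x, p) \<in> B" "(x, q) \<in> B" using fst_eq by fastforce+
        have bounds: "p \<le> z \<and> z \<le> q" if "(y, z) \<in> B" for y z
        proof -
          have "z \<in> snd ` B" using that by force
          then show ?thesis unfolding p_def q_def using fin by simp
        qed
        have "B = {x} \<times> {p..q}"
        proof (intro equalityI subsetI)
          fix b assume "b \<in> B"
          then show "b \<in> {x} \<times> {p..q}" using fst_eq[of b] bounds by (cases b) auto
        qed (use row[OF ends] in auto)
        moreover have "p \<le> q" using bounds ends by auto
        ultimately have "horizontal_strip B" unfolding horizontal_strip_def by blast
        moreover have ?con
        proof (rule connected_via_mono[OF con])
          fix b c assume *: "b \<in> B" "c \<in> B" "(b, c) \<in> link F"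
          then show "(b, c) \<in> edge_adjacent"
            using fst_eq False by (cases b, cases c) (auto simp: link_def edge_adjacent_def Dual_Immaculate)
        qed
        ultimately show ?thesis by blast
      qed
    qed
    show ?thesis
      using skew strip by (simp add: Dual_Immaculate border_strip_dual_immaculate_def rib[unfolded Dual_Immaculate])
  qed
qed

lemma weak_filling_cd_iff:
  "weak_filling F (cd \<alpha>) T \<longleftrightarrow>
    rows_ordered (\<le>) \<alpha> T \<and> (\<forall>z. relevant_column F z \<longrightarrow> column_ordered (\<le>) \<alpha> T z)"
  unfolding weak_filling_def rows_ordered_def column_ordered_def by blast

text \<open>The boxes carrying i are the difference of the lower sets for i and i - 1, so they form
  a skew diagram for every weak filling, and only the ribbon condition is left to impose.\<close>

lemma BST_eq:
  assumes pos: "positive \<alpha>"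
  shows "BST F \<alpha> \<beta> = {T \<in> fillings F (cd \<alpha>) \<beta>. \<forall>i \<in> {1..length \<beta>}. ribbon F (occupied \<alpha> T i)}"
proof -
  have skew: "skew_diagram F \<alpha> (occupied \<alpha> T i)" if T: "weak_filling F (cd \<alpha>) T" "1 \<le> i" for T i
    unfolding skew_diagram_def
  proof (intro exI conjI)
    show "lower_set F \<alpha> {b \<in> cd \<alpha>. T b \<le> i}" "lower_set F \<alpha> {b \<in> cd \<alpha>. T b \<le> i - 1}"
      using lower_set_level[OF lower_set_cd T(1)] by blast+
    show "occupied \<alpha> T i = {b \<in> cd \<alpha>. T b \<le> i} - {b \<in> cd \<alpha>. T b \<le> i - 1}"
      using T(2) by (auto simp: occupied_def)
  qed
  have "T \<in> BST F \<alpha> \<beta> \<longleftrightarrow>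
      T \<in> fillings F (cd \<alpha>) \<beta> \<and> (\<forall>i \<in> {1..length \<beta>}. ribbon F (occupied \<alpha> T i))" for T
  proof (cases "weak_filling F (cd \<alpha>) T")
    case True
    then have "border_strip F \<alpha> (occupied \<alpha> T i) \<longleftrightarrow> ribbon F (occupied \<alpha> T i)" if "i \<in> {1..length \<beta>}" for i
      using border_strip_iff_ribbon[OF pos skew] that by simp
    then show ?thesis
      using True unfolding BST_def fillings_def mem_Collect_eq weak_filling_cd_iff occupied_def[symmetric]
      by blast
  next
    case False
    then show ?thesis
      unfolding BST_def fillings_def mem_Collect_eq weak_filling_cd_iff by blast
  qed
  then show ?thesis by blast
qed

lemma weighted_strip_sign:
  assumes pos: "positive \<alpha>"
  shows "weighted F (strip_sign F) (cd \<alpha>) \<beta> = (\<Sum>T \<in> BST F \<alpha> \<beta>. (-1) ^ tableau_height \<alpha> T)"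
proof -
  have "weighted F (strip_sign F) (cd \<alpha>) \<beta> =
      (\<Sum>T \<in> BST F \<alpha> \<beta>. \<Prod>i = 1..length \<beta>. strip_sign F (occupied \<alpha> T i))"
    unfolding weighted_def occupied_def[symmetric]
  proof (rule sum.mono_neutral_right)
    show "finite (fillings F (cd \<alpha>) \<beta>)" by (simp add: finite_fillings)
    show "BST F \<alpha> \<beta> \<subseteq> fillings F (cd \<alpha>) \<beta>" unfolding BST_eq[OF pos] by blast
    show "\<forall>T \<in> fillings F (cd \<alpha>) \<beta> - BST F \<alpha> \<beta>. (\<Prod>i = 1..length \<beta>. strip_sign F (occupied \<alpha> T i)) = 0"
    proof
      fix T assume "T \<in> fillings F (cd \<alpha>) \<beta> - BST F \<alpha> \<beta>"
      then obtain i where "i \<in> {1..length \<beta>}" "\<not> ribbon F (occupied \<alpha> T i)"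
        unfolding BST_eq[OF pos] by blast
      then show "(\<Prod>i = 1..length \<beta>. strip_sign F (occupied \<alpha> T i)) = 0"
        by (intro prod_zero) (auto simp: strip_sign_def)
    qed
  qed
  also have "\<dots> = (\<Sum>T \<in> BST F \<alpha> \<beta>. (-1) ^ tableau_height \<alpha> T)"
  proof (rule sum.cong[OF refl])
    fix T assume "T \<in> BST F \<alpha> \<beta>"
    then have T: "T \<in> fillings F (cd \<alpha>) \<beta>" and rib: "\<And>i. i \<in> {1..length \<beta>} \<Longrightarrow> ribbon F (occupied \<alpha> T i)"
      unfolding BST_eq[OF pos] by blast+
    have "occupied \<alpha> T i \<noteq> {}" if "i \<in> {1..length \<beta>}" for i
      using rib[OF that] by (simp add: ribbon_def connected_via_def)
    then have "{1..length \<beta>} \<subseteq> T ` cd \<alpha>"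
      by (force simp: occupied_def)
    moreover have "T ` cd \<alpha> \<subseteq> {1..length \<beta>}"
      using T by (force simp: fillings_def)
    ultimately have "T ` cd \<alpha> = {1..length \<beta>}" by blast
    then have "tableau_height \<alpha> T = (\<Sum>i = 1..length \<beta>. strip_height (occupied \<alpha> T i))"
      by (simp add: tableau_height_def)
    then show "(\<Prod>i = 1..length \<beta>. strip_sign F (occupied \<alpha> T i)) = (-1) ^ tableau_height \<alpha> T"
      using rib by (simp add: power_sum strip_sign_def)
  qed
  finally show ?thesis .
qed

section \<open>Standardization\<close>

text \<open>Equal entries are read from the bottom row to the top row: no descent may occur among them.\<close>

definition box_less :: "(box \<Rightarrow> nat) \<Rightarrow> box \<Rightarrow> box \<Rightarrow> bool" where
  "box_less f b c \<longleftrightarrow> f b < f c \<or>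
     f b = f c \<and> (fst c < fst b \<or> fst b = fst c \<and> snd b < snd c)"

definition standardization :: "nat list \<Rightarrow> (box \<Rightarrow> nat) \<Rightarrow> box \<Rightarrow> nat" where
  "standardization \<alpha> f = (\<lambda>b \<in> cd \<alpha>. Suc (card {c \<in> cd \<alpha>. box_less f c b}))"

definition standard_fillings :: "family \<Rightarrow> nat list \<Rightarrow> (box \<Rightarrow> nat) set" where
  "standard_fillings F \<alpha> = {T \<in> bijective_fillings \<alpha>. rows_ordered (<) \<alpha> T \<and>
     (\<forall>z. relevant_column F z \<longrightarrow> column_ordered (<) \<alpha> T z)}"

definition semistandard_fillings :: "family \<Rightarrow> nat list \<Rightarrow> (box \<Rightarrow> nat) set" where
  "semistandard_fillings F \<alpha> = {f \<in> cd \<alpha> \<rightarrow>\<^sub>E {1..}. weak_filling F (cd \<alpha>) f \<and>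
     (\<forall>i. column_free F {b \<in> cd \<alpha>. f b = i})}"

lemma box_less_trans: "box_less f b c \<Longrightarrow> box_less f c d \<Longrightarrow> box_less f b d"
  unfolding box_less_def by auto

lemma box_less_irrefl [simp]: "\<not> box_less f b b"
  unfolding box_less_def by auto

lemma box_less_total: "b \<noteq> c \<Longrightarrow> box_less f b c \<or> box_less f c b"
  unfolding box_less_def by (cases b, cases c) auto

lemma box_less_imp_le: "box_less f b c \<Longrightarrow> f b \<le> f c"
  unfolding box_less_def by auto

lemma standardization_less:
  assumes "b \<in> cd \<alpha>" "c \<in> cd \<alpha>" "box_less f b c"
  shows "standardization \<alpha> f b < standardization \<alpha> f c"
proof -
  have "{d \<in> cd \<alpha>. box_less f d b} \<subset> {d \<in> cd \<alpha>. box_less f d c}"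
    using assms box_less_trans box_less_irrefl by blast
  then show ?thesis
    using assms by (simp add: standardization_def psubset_card_mono)
qed

lemma standardization_less_iff:
  assumes "b \<in> cd \<alpha>" "c \<in> cd \<alpha>"
  shows "standardization \<alpha> f b < standardization \<alpha> f c \<longleftrightarrow> box_less f b c"
  using standardization_less[OF assms] standardization_less[OF assms(2,1)] box_less_total[of b c f]
  by (metis not_less_iff_gr_or_eq)

lemma standardization_bijective: "standardization \<alpha> f \<in> bijective_fillings \<alpha>"
proof -
  have inj: "inj_on (standardization \<alpha> f) (cd \<alpha>)"
  proof (rule inj_onI)
    fix b c assume *: "b \<in> cd \<alpha>" "c \<in> cd \<alpha>" "standardization \<alpha> f b = standardization \<alpha> f c"
    then show "b = c"
      using standardization_less_iff[OF *(1,2), of f] standardization_less_iff[OF *(2,1), of f]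
        box_less_total[of b c f] by auto
  qed
  have "standardization \<alpha> f ` cd \<alpha> \<subseteq> {1..sum_list \<alpha>}"
  proof
    fix r assume "r \<in> standardization \<alpha> f ` cd \<alpha>"
    then obtain b where b: "b \<in> cd \<alpha>" "r = Suc (card {c \<in> cd \<alpha>. box_less f c b})"
      by (auto simp: standardization_def)
    have "card {c \<in> cd \<alpha>. box_less f c b} < card (cd \<alpha>)"
    proof (rule psubset_card_mono)
      have "b \<notin> {c \<in> cd \<alpha>. box_less f c b}" by simp
      then show "{c \<in> cd \<alpha>. box_less f c b} \<subset> cd \<alpha>" using b(1) by blast
    qed simp
    then show "r \<in> {1..sum_list \<alpha>}" using b by (simp add: card_cd)
  qed
  moreover have "card (standardization \<alpha> f ` cd \<alpha>) = card {1..sum_list \<alpha>}"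
    using inj by (simp add: card_image card_cd)
  ultimately have "standardization \<alpha> f ` cd \<alpha> = {1..sum_list \<alpha>}"
    by (intro card_subset_eq) auto
  then show ?thesis
    using inj by (simp add: bijective_fillings_def bij_betw_def standardization_def)
qed

text \<open>T and the order \<open>box_less\<close> enumerate the boxes in the same order, and a
  bijective filling assigns to each box one more than the number of boxes with smaller
  entry.\<close>

lemma standardization_unique:
  assumes T: "T \<in> bijective_fillings \<alpha>"
    and less: "\<And>b c. b \<in> cd \<alpha> \<Longrightarrow> c \<in> cd \<alpha> \<Longrightarrow> T b < T c \<Longrightarrow> box_less f b c"
  shows "standardization \<alpha> f = T"
proof
  fix b
  have ext: "T \<in> extensional (cd \<alpha>)" and bij: "bij_betw T (cd \<alpha>) {1..sum_list \<alpha>}"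
    using T by (auto simp: bijective_fillings_def)
  show "standardization \<alpha> f b = T b"
  proof (cases "b \<in> cd \<alpha>")
    case True
    have Tb: "T b \<in> {1..sum_list \<alpha>}" using bij True by (auto simp: bij_betw_def)
    have "box_less f c b \<longleftrightarrow> T c < T b" if "c \<in> cd \<alpha>" for c
    proof (cases "c = b")
      case False
      then have "T c \<noteq> T b" using bij that True by (auto simp: bij_betw_def inj_on_def)
      then show ?thesis
        using less[OF that True] less[OF True that] box_less_trans[of f b c b] by force
    qed simp
    then have "{c \<in> cd \<alpha>. box_less f c b} = {c \<in> cd \<alpha>. T c < T b}" by blast
    moreover have "bij_betw T {c \<in> cd \<alpha>. T c < T b} {1..<T b}"
    proof (rule bij_betw_subset[OF bij])
      show "T ` {c \<in> cd \<alpha>. T c < T b} = {1..<T b}"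
      proof (intro equalityI subsetI)
        fix i assume i: "i \<in> {1..<T b}"
        then have "i \<in> T ` cd \<alpha>" using bij Tb by (auto simp: bij_betw_def)
        then show "i \<in> T ` {c \<in> cd \<alpha>. T c < T b}" using i by auto
      next
        fix i assume "i \<in> T ` {c \<in> cd \<alpha>. T c < T b}"
        then show "i \<in> {1..<T b}" using bij by (auto simp: bij_betw_def)
      qed
    qed blast
    then have "card {c \<in> cd \<alpha>. T c < T b} = T b - 1" by (simp add: bij_betw_same_card)
    ultimately show ?thesis using True Tb by (simp add: standardization_def)
  next
    case False
    then show ?thesis using extensional_arb[OF ext] by (simp add: standardization_def)
  qed
qed

text \<open>Equal entries in one relevant column would be numbered from bottom to top and violate
  the column order; \<open>column_free\<close> rules them out.\<close>

lemma standardization_standard: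
  assumes f: "f \<in> semistandard_fillings F \<alpha>"
  shows "standardization \<alpha> f \<in> standard_fillings F \<alpha>"
proof -
  have weak: "weak_filling F (cd \<alpha>) f" and free: "\<And>i. column_free F {b \<in> cd \<alpha>. f b = i}"
    using f by (auto simp: semistandard_fillings_def)
  have "rows_ordered (<) \<alpha> (standardization \<alpha> f)"
    unfolding rows_ordered_def
  proof (intro allI impI standardization_less)
    fix x z w assume *: "(x, z) \<in> cd \<alpha> \<and> (x, w) \<in> cd \<alpha> \<and> z < w"
    then have "f (x, z) \<le> f (x, w)" using weak unfolding weak_filling_def by blast
    then show "box_less f (x, z) (x, w)" using * by (auto simp: box_less_def)
  qed auto
  moreover have "column_ordered (<) \<alpha> (standardization \<alpha> f) z" if z: "relevant_column F z" for z
    unfolding column_ordered_def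
  proof (intro allI impI standardization_less)
    fix x y assume *: "(x, z) \<in> cd \<alpha> \<and> (y, z) \<in> cd \<alpha> \<and> x < y"
    then have "f (x, z) \<le> f (y, z)" using weak z unfolding weak_filling_def by blast
    moreover have "f (x, z) \<noteq> f (y, z)"
    proof
      assume "f (x, z) = f (y, z)"
      then have "(x, z) \<in> {b \<in> cd \<alpha>. f b = f (y, z)}" "(y, z) \<in> {b \<in> cd \<alpha>. f b = f (y, z)}"
        using * by auto
      then have "x = y" using free[of "f (y, z)"] z unfolding column_free_def by blast
      then show False using * by simp
    qed
    ultimately show "box_less f (x, z) (y, z)" by (simp add: box_less_def)
  qed auto
  ultimately show ?thesis
    using standardization_bijective by (simp add: standard_fillings_def)
qed

section \<open>Pairs of a standard filling and a word, and the semistandard fillings they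
  encode\<close>

definition words :: "nat list \<Rightarrow> (box \<Rightarrow> nat) \<Rightarrow> nat list set" where
  "words \<alpha> T = {I. length I = sum_list \<alpha> \<and> (\<forall>i \<in> set I. 1 \<le> i) \<and> sorted I \<and>
     (\<forall>j \<in> descents \<alpha> T. I ! (j - 1) < I ! j)}"

text \<open>Inverse of standardization for given T: the box numbered k receives the k-th letter,
  which sits at list position k - 1.\<close>

definition filling_of :: "nat list \<Rightarrow> (box \<Rightarrow> nat) \<Rightarrow> nat list \<Rightarrow> box \<Rightarrow> nat" where
  "filling_of \<alpha> T I = (\<lambda>b \<in> cd \<alpha>. I ! (T b - 1))"

definition reading_word :: "nat list \<Rightarrow> (box \<Rightarrow> nat) \<Rightarrow> (box \<Rightarrow> nat) \<Rightarrow> nat list" where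
  "reading_word \<alpha> T f = map (\<lambda>j. f (inv_into (cd \<alpha>) T (Suc j))) [0..<sum_list \<alpha>]"

context
  fixes \<alpha> :: "nat list" and T :: "box \<Rightarrow> nat"
  assumes T: "T \<in> bijective_fillings \<alpha>"
begin

lemma bij_T: "bij_betw T (cd \<alpha>) {1..sum_list \<alpha>}"
  using T by (simp add: bijective_fillings_def)

lemma T_range: "b \<in> cd \<alpha> \<Longrightarrow> 1 \<le> T b \<and> T b \<le> sum_list \<alpha>"
  using bij_T by (auto simp: bij_betw_def)

lemma inv_T:
  assumes "1 \<le> i" "i \<le> sum_list \<alpha>"
  shows "inv_into (cd \<alpha>) T i \<in> cd \<alpha>" "T (inv_into (cd \<alpha>) T i) = i"
proof -
  have "i \<in> T ` cd \<alpha>" using bij_T assms by (simp add: bij_betw_def)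
  then show "inv_into (cd \<alpha>) T i \<in> cd \<alpha>" "T (inv_into (cd \<alpha>) T i) = i"
    by (auto intro: inv_into_into f_inv_into_f)
qed

lemma inv_T_T: "b \<in> cd \<alpha> \<Longrightarrow> inv_into (cd \<alpha>) T (T b) = b"
  using bij_T by (simp add: bij_betw_def inv_into_f_f)

lemma filling_of_reading_word:
  assumes "f \<in> extensional (cd \<alpha>)"
  shows "filling_of \<alpha> T (reading_word \<alpha> T f) = f"
proof
  fix b
  show "filling_of \<alpha> T (reading_word \<alpha> T f) b = f b"
  proof (cases "b \<in> cd \<alpha>")
    case True
    then have "T b - 1 < sum_list \<alpha>" "Suc (T b - 1) = T b" using T_range[OF True] by auto
    then show ?thesis using True by (simp add: filling_of_def reading_word_def inv_T_T)
  next
    case False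
    then show ?thesis using extensional_arb[OF assms] by (simp add: filling_of_def)
  qed
qed

lemma reading_word_filling_of:
  assumes "length I = sum_list \<alpha>"
  shows "reading_word \<alpha> T (filling_of \<alpha> T I) = I"
  using assms inv_T by (intro nth_equalityI) (simp_all add: reading_word_def filling_of_def)

lemma sum_filling_of:
  fixes g :: "nat \<Rightarrow> 'a :: comm_monoid_add"
  assumes "length I = sum_list \<alpha>"
  shows "(\<Sum>b \<in> cd \<alpha>. g (filling_of \<alpha> T I b)) = (\<Sum>j < sum_list \<alpha>. g (I ! j))"
proof (rule sum.reindex_bij_witness[of _ "\<lambda>j. inv_into (cd \<alpha>) T (Suc j)" "\<lambda>b. T b - 1"])
  fix b assume b: "b \<in> cd \<alpha>"
  then show "inv_into (cd \<alpha>) T (Suc (T b - 1)) = b" "T b - 1 \<in> {..<sum_list \<alpha>}"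
    using T_range[OF b] by (auto simp: inv_T_T)
  show "g (I ! (T b - 1)) = g (filling_of \<alpha> T I b)" using b by (simp add: filling_of_def)
next
  fix j assume "j \<in> {..<sum_list \<alpha>}"
  then show "T (inv_into (cd \<alpha>) T (Suc j)) - 1 = j" "inv_into (cd \<alpha>) T (Suc j) \<in> cd \<alpha>"
    using inv_T[of "Suc j"] by auto
qed

text \<open>If b and c receive equal letters, the sorted word is constant between their positions,
  so no descent occurs there.\<close>

lemma box_less_filling_of:
  assumes rows: "rows_ordered (<) \<alpha> T" and I: "I \<in> words \<alpha> T"
    and bc: "b \<in> cd \<alpha>" "c \<in> cd \<alpha>" "T b < T c"
  shows "box_less (filling_of \<alpha> T I) b c"
proof -
  let ?B = "inv_into (cd \<alpha>) T"
  have len: "length I = sum_list \<alpha>" and sorted: "sorted I"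
    and desc: "\<And>j. j \<in> descents \<alpha> T \<Longrightarrow> I ! (j - 1) < I ! j"
    using I by (auto simp: words_def)
  have mono: "I ! i \<le> I ! j" if "i \<le> j" "j < sum_list \<alpha>" for i j
    using sorted_nth_mono[OF sorted that(1)] that(2) len by simp
  have f_le: "filling_of \<alpha> T I b \<le> filling_of \<alpha> T I c"
    using bc mono[of "T b - 1" "T c - 1"] T_range[OF bc(2)] by (simp add: filling_of_def)
  show ?thesis
  proof (cases "filling_of \<alpha> T I b = filling_of \<alpha> T I c")
    case False
    then show ?thesis using f_le by (simp add: box_less_def)
  next
    case True
    \<comment> \<open>Without a descent at k, the box numbered k + 1 is not in a row strictly below
      that of k; the row index can only decrease on the way from b to c.\<close>
    have "T b \<le> k \<Longrightarrow> k \<le> T c \<longrightarrow> fst (?B k) \<le> fst b" for k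
    proof (induction k rule: dec_induct)
      case base
      then show ?case using bc by (simp add: inv_T_T)
    next
      case (step k)
      show ?case
      proof
        assume k: "Suc k \<le> T c"
        have range: "1 \<le> k" "k < sum_list \<alpha>" using step(1) k T_range[OF bc(1)] T_range[OF bc(2)] by auto
        have "I ! (T b - 1) \<le> I ! (k - 1)" "I ! k \<le> I ! (T c - 1)"
          using step(1) k range T_range[OF bc(2)] by (auto intro!: mono)
        moreover have "I ! (T b - 1) = I ! (T c - 1)" using True bc by (simp add: filling_of_def)
        ultimately have "k \<notin> descents \<alpha> T" using desc[of k] by fastforce
        moreover have "?B k \<in> cd \<alpha>" "?B (Suc k) \<in> cd \<alpha>" "T (?B k) = k" "T (?B (Suc k)) = Suc k"
          using inv_T[of k] inv_T[of "Suc k"] range by auto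
        ultimately have "fst (?B (Suc k)) \<le> fst (?B k)"
          using range unfolding descents_def by fastforce
        then show "fst (?B (Suc k)) \<le> fst b" using step k by auto
      qed
    qed
    from this[of "T c"] have fst_le: "fst c \<le> fst b" using bc by (simp add: inv_T_T)
    have "snd b < snd c" if eq: "fst b = fst c"
    proof (rule ccontr)
      assume "\<not> snd b < snd c"
      moreover have "snd b \<noteq> snd c" using eq bc(3) by (metis less_irrefl prod_eqI)
      ultimately have "snd c < snd b" by simp
      then have "T (fst c, snd c) < T (fst c, snd b)"
        using rows bc(1,2) eq unfolding rows_ordered_def by (metis prod.collapse)
      then show False using eq bc(3) by (metis less_asym prod.collapse)
    qed
    then show ?thesis using True fst_le by (auto simp: box_less_def)
  qed
qed

end

text \<open>In a column, \<open>box_less\<close> from an upper to a lower box excludes equal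
  entries, since ties are read from the bottom; this gives the column condition.\<close>

lemma filling_of_semistandard:
  assumes T: "T \<in> standard_fillings F \<alpha>" and I: "I \<in> words \<alpha> T"
  shows "filling_of \<alpha> T I \<in> semistandard_fillings F \<alpha>"
    and "standardization \<alpha> (filling_of \<alpha> T I) = T"
proof -
  have T': "T \<in> bijective_fillings \<alpha>" and rows: "rows_ordered (<) \<alpha> T"
    and cols: "\<And>z. relevant_column F z \<Longrightarrow> column_ordered (<) \<alpha> T z"
    using T by (auto simp: standard_fillings_def)
  note less = box_less_filling_of[OF T' rows I]
  show "standardization \<alpha> (filling_of \<alpha> T I) = T"
    by (rule standardization_unique[OF T' less])
  let ?f = "filling_of \<alpha> T I"
  have col_less: "box_less ?f (x, z) (y, z)"
    if "(x, z) \<in> cd \<alpha>" "(y, z) \<in> cd \<alpha>" "x < y" "relevant_column F z" for x y z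
    using that cols[OF that(4)] unfolding column_ordered_def by (intro less) auto
  have "?f b \<in> {1..}" if "b \<in> cd \<alpha>" for b
  proof -
    have "I ! (T b - 1) \<in> set I"
      using T_range[OF T' that] I by (intro nth_mem) (auto simp: words_def)
    then show ?thesis using I that by (simp add: filling_of_def words_def)
  qed
  then have "?f \<in> cd \<alpha> \<rightarrow>\<^sub>E {1..}" by (auto simp: filling_of_def)
  moreover have "weak_filling F (cd \<alpha>) ?f"
    unfolding weak_filling_def
  proof (intro conjI allI impI)
    fix x z w assume *: "(x, z) \<in> cd \<alpha> \<and> (x, w) \<in> cd \<alpha> \<and> z < w"
    then have "T (x, z) < T (x, w)" using rows unfolding rows_ordered_def by blast
    then show "?f (x, z) \<le> ?f (x, w)" using less * box_less_imp_le by blast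
  next
    fix x y z assume "(x, z) \<in> cd \<alpha> \<and> (y, z) \<in> cd \<alpha> \<and> x < y \<and> relevant_column F z"
    then show "?f (x, z) \<le> ?f (y, z)" using col_less box_less_imp_le by blast
  qed
  moreover have "column_free F {b \<in> cd \<alpha>. ?f b = i}" for i
    unfolding column_free_def
  proof (intro allI impI, rule ccontr)
    fix x y z
    assume *: "(x, z) \<in> {b \<in> cd \<alpha>. ?f b = i} \<and> (y, z) \<in> {b \<in> cd \<alpha>. ?f b = i} \<and> relevant_column F z" "x \<noteq> y"
    then have "x < y \<Longrightarrow> box_less ?f (x, z) (y, z)" "y < x \<Longrightarrow> box_less ?f (y, z) (x, z)"
      using col_less by auto
    moreover have "x < y \<or> y < x" using *(2) by linarith
    ultimately show False using *(1) by (auto simp: box_less_def)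
  qed
  ultimately show "?f \<in> semistandard_fillings F \<alpha>"
    by (simp add: semistandard_fillings_def)
qed

lemma reading_word_in_words:
  assumes f: "f \<in> semistandard_fillings F \<alpha>"
  shows "reading_word \<alpha> (standardization \<alpha> f) f \<in> words \<alpha> (standardization \<alpha> f)"
proof -
  let ?T = "standardization \<alpha> f"
  let ?B = "inv_into (cd \<alpha>) ?T"
  note T = standardization_bijective[of \<alpha> f]
  note inv = inv_T[OF T]
  have nth: "reading_word \<alpha> ?T f ! j = f (?B (Suc j))" if "j < sum_list \<alpha>" for j
    using that by (simp add: reading_word_def)
  have pos: "1 \<le> f b" if "b \<in> cd \<alpha>" for b
    using f that by (auto simp: semistandard_fillings_def)
  have "\<forall>i \<in> set (reading_word \<alpha> ?T f). 1 \<le> i"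
    using inv(1) pos by (auto simp: reading_word_def)
  moreover have "sorted (reading_word \<alpha> ?T f)"
    unfolding sorted_iff_nth_mono_less
  proof (intro allI impI)
    fix i j assume ij: "i < j" "j < length (reading_word \<alpha> ?T f)"
    then have "j < sum_list \<alpha>" by (simp add: reading_word_def)
    then have "box_less f (?B (Suc i)) (?B (Suc j))"
      using ij inv[of "Suc i"] inv[of "Suc j"]
      by (subst standardization_less_iff[where \<alpha> = \<alpha>, symmetric]) auto
    then show "reading_word \<alpha> ?T f ! i \<le> reading_word \<alpha> ?T f ! j"
      using ij \<open>j < sum_list \<alpha>\<close> by (simp add: nth box_less_imp_le)
  qed
  moreover have "reading_word \<alpha> ?T f ! (j - 1) < reading_word \<alpha> ?T f ! j" if "j \<in> descents \<alpha> ?T" for j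
  proof -
    obtain b c where j: "1 \<le> j" "j < sum_list \<alpha>" "b \<in> cd \<alpha>" "c \<in> cd \<alpha>" "?T b = j" "?T c = j + 1" "fst b < fst c"
      using \<open>j \<in> descents \<alpha> ?T\<close> by (auto simp: descents_def)
    have "box_less f b c"
      using j standardization_less_iff[of b \<alpha> c f] by simp
    \<comment> \<open>A tie would place the box of the lower row first, against the descent.\<close>
    then have "f b < f c" using j(7) by (auto simp: box_less_def)
    moreover have "?B j = b" "?B (Suc j) = c"
      using inv_T_T[OF T j(3)] inv_T_T[OF T j(4)] j by auto
    ultimately show ?thesis using j by (simp add: nth)
  qed
  ultimately show ?thesis by (simp add: words_def) (simp add: reading_word_def)
qed

text \<open>A fixed value of a sum over the entries is carried along, so that the bijection matches
  exactly the two sets that compute one coefficient.\<close>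

lemma bij_betw_standardization:
  "bij_betw (\<lambda>(T, I). filling_of \<alpha> T I)
    (Sigma (standard_fillings F \<alpha>) (\<lambda>T. {I \<in> words \<alpha> T. (\<Sum>j < sum_list \<alpha>. g (I ! j)) = m}))
    {f \<in> semistandard_fillings F \<alpha>. (\<Sum>b \<in> cd \<alpha>. g (f b)) = (m :: 'a :: comm_monoid_add)}"
proof (rule bij_betw_byWitness[where
      f' = "\<lambda>f. (standardization \<alpha> f, reading_word \<alpha> (standardization \<alpha> f) f)"])
  let ?P = "Sigma (standard_fillings F \<alpha>) (\<lambda>T. {I \<in> words \<alpha> T. (\<Sum>j < sum_list \<alpha>. g (I ! j)) = m})"
  let ?Q = "{f \<in> semistandard_fillings F \<alpha>. (\<Sum>b \<in> cd \<alpha>. g (f b)) = m}"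
  have bij: "T \<in> bijective_fillings \<alpha>" if "T \<in> standard_fillings F \<alpha>" for T
    using that by (simp add: standard_fillings_def)
  have len: "length I = sum_list \<alpha>" if "I \<in> words \<alpha> T" for I T
    using that by (simp add: words_def)
  have ext: "f \<in> extensional (cd \<alpha>)" if "f \<in> semistandard_fillings F \<alpha>" for f
    using that by (simp add: semistandard_fillings_def PiE_def)
  have inverse: "filling_of \<alpha> (standardization \<alpha> f) (reading_word \<alpha> (standardization \<alpha> f) f) = f"
    if "f \<in> semistandard_fillings F \<alpha>" for f
    by (rule filling_of_reading_word[OF standardization_bijective ext[OF that]])
  show "\<forall>p \<in> ?P. (\<lambda>f. (standardization \<alpha> f, reading_word \<alpha> (standardization \<alpha> f) f))
      ((\<lambda>(T, I). filling_of \<alpha> T I) p) = p"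
    using filling_of_semistandard(2) reading_word_filling_of[OF bij len] by auto
  show "\<forall>f \<in> ?Q. (\<lambda>(T, I). filling_of \<alpha> T I)
      (standardization \<alpha> f, reading_word \<alpha> (standardization \<alpha> f) f) = f"
    using inverse by auto
  show "(\<lambda>(T, I). filling_of \<alpha> T I) ` ?P \<subseteq> ?Q"
    using filling_of_semistandard(1) sum_filling_of[OF bij len] by auto
  show "(\<lambda>f. (standardization \<alpha> f, reading_word \<alpha> (standardization \<alpha> f) f)) ` ?Q \<subseteq> ?P"
  proof
    fix p assume "p \<in> (\<lambda>f. (standardization \<alpha> f, reading_word \<alpha> (standardization \<alpha> f) f)) ` ?Q"
    then obtain f where f: "f \<in> semistandard_fillings F \<alpha>" "(\<Sum>b \<in> cd \<alpha>. g (f b)) = m"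
      and p: "p = (standardization \<alpha> f, reading_word \<alpha> (standardization \<alpha> f) f)" by auto
    have "(\<Sum>j < sum_list \<alpha>. g (reading_word \<alpha> (standardization \<alpha> f) f ! j)) = m"
      using sum_filling_of[OF standardization_bijective len[OF reading_word_in_words[OF f(1)]], of g f]
        f inverse[OF f(1)] by simp
    then show "p \<in> ?P"
      using p f standardization_standard reading_word_in_words by auto
  qed
qed

lemma lookup_sum_single:
  "finite A \<Longrightarrow> Poly_Mapping.lookup (\<Sum>a \<in> A. Poly_Mapping.single (k a) (v a)) i = (\<Sum>a \<in> {a \<in> A. k a = i}. v a)"
  by (simp add: lookup_sum lookup_single when_def sum.inter_filter)

text \<open>The letters lie in the support of the monomial. Without finiteness the cardinality in
  \<open>monomial_sum\<close> would be 0 by convention and could not be added up.\<close>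

lemma finite_words_content:
  "finite {I \<in> words \<alpha> T. (\<Sum>j < sum_list \<alpha>. Poly_Mapping.single (I ! j) (1 :: nat)) = m}"
proof (rule finite_subset)
  show "{I \<in> words \<alpha> T. (\<Sum>j < sum_list \<alpha>. Poly_Mapping.single (I ! j) (1 :: nat)) = m} \<subseteq>
      {I. set I \<subseteq> Poly_Mapping.keys m \<and> length I = sum_list \<alpha>}"
  proof
    fix I assume "I \<in> {I \<in> words \<alpha> T. (\<Sum>j < sum_list \<alpha>. Poly_Mapping.single (I ! j) (1 :: nat)) = m}"
    then have len: "length I = sum_list \<alpha>"
      and m: "m = (\<Sum>j < sum_list \<alpha>. Poly_Mapping.single (I ! j) 1)"
      by (auto simp: words_def)
    have "i \<in> Poly_Mapping.keys m" if i: "i \<in> set I" for i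
    proof -
      obtain j where "j < sum_list \<alpha>" "I ! j = i" using i len by (auto simp: in_set_conv_nth)
      then have "{j \<in> {..<sum_list \<alpha>}. I ! j = i} \<noteq> {}" by blast
      then have "card {j \<in> {..<sum_list \<alpha>}. I ! j = i} \<noteq> 0" by simp
      then show ?thesis unfolding m in_keys_iff by (simp add: lookup_sum_single)
    qed
    then show "I \<in> {I. set I \<subseteq> Poly_Mapping.keys m \<and> length I = sum_list \<alpha>}"
      using len by blast
  qed
qed (simp add: finite_lists_length_eq)

text \<open>The fundamental function attached to T enumerates \<open>words\<close> of T, because
  \<open>comp_of\<close> returns a composition whose set is the descent set; standardization merges
  all pairs of T and word into semistandard fillings.\<close>

theorem Y_coefficient:
  assumes pos: "positive \<alpha>"
  shows "Y F \<alpha> m = of_nat (card {f \<in> semistandard_fillings F \<alpha>.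
    (\<Sum>b \<in> cd \<alpha>. Poly_Mapping.single (f b) 1) = m})"
proof -
  let ?W = "\<lambda>T. {I \<in> words \<alpha> T. (\<Sum>j < sum_list \<alpha>. Poly_Mapping.single (I ! j) 1) = m}"
  have "finite (bijective_fillings \<alpha>)"
  proof (rule finite_subset)
    show "bijective_fillings \<alpha> \<subseteq> cd \<alpha> \<rightarrow>\<^sub>E {1..sum_list \<alpha>}"
      by (auto simp: bijective_fillings_def bij_betw_def PiE_def)
  qed (simp add: finite_PiE)
  then have fin: "finite (standard_fillings F \<alpha>)"
    by (simp add: standard_fillings_def)
  have "Y F \<alpha> m = (\<Sum>T \<in> standard_fillings F \<alpha>. fundamental (comp_of (sum_list \<alpha>) (descents \<alpha> T)) m)"
    by (cases F) (simp_all add: standard_fillings_def dual_immaculate_def extended_schur_def)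
  also have "\<dots> = (\<Sum>T \<in> standard_fillings F \<alpha>. of_nat (card (?W T)))"
  proof (rule sum.cong[OF refl])
    fix T
    have "descents \<alpha> T \<subseteq> {1..<sum_list \<alpha>}" by (auto simp: descents_def)
    from comp_of[OF this] show "fundamental (comp_of (sum_list \<alpha>) (descents \<alpha> T)) m = of_nat (card (?W T))"
      by (simp add: fundamental_def monomial_sum_def words_def compositions_iff)
  qed
  also have "\<dots> = of_nat (card (Sigma (standard_fillings F \<alpha>) ?W))"
    using fin finite_words_content by (simp add: card_SigmaI)
  also have "card (Sigma (standard_fillings F \<alpha>) ?W) =
      card {f \<in> semistandard_fillings F \<alpha>. (\<Sum>b \<in> cd \<alpha>. Poly_Mapping.single (f b) 1) = m}"
    by (rule bij_betw_same_card[OF bij_betw_standardization])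
  finally show ?thesis .
qed

section \<open>Comparison of coefficients\<close>

definition content_monomial :: "nat list \<Rightarrow> monomial" where
  "content_monomial \<gamma> = (\<Sum>j < length \<gamma>. Poly_Mapping.single (Suc j) (\<gamma> ! j))"

lemma lookup_content_monomial:
  "Poly_Mapping.lookup (content_monomial \<gamma>) i = (if i \<in> {1..length \<gamma>} then \<gamma> ! (i - 1) else 0)"
proof -
  have "{j \<in> {..<length \<gamma>}. Suc j = i} = (if i \<in> {1..length \<gamma>} then {i - 1} else {})"
    by auto
  then show ?thesis by (simp add: content_monomial_def lookup_sum_single)
qed

text \<open>A semistandard filling has no upper bound on its entries; here the bound comes from the
  monomial, in which variables beyond the length of \<gamma> have exponent 0.\<close>

lemma semistandard_content:
  "{f \<in> semistandard_fillings F \<alpha>. (\<Sum>b \<in> cd \<alpha>. Poly_Mapping.single (f b) 1) = content_monomial \<gamma>} =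
    {f \<in> fillings F (cd \<alpha>) \<gamma>. \<forall>i \<in> {1..length \<gamma>}. column_free F {b \<in> cd \<alpha>. f b = i}}"
  (is "?L = ?R")
proof -
  have content: "(\<Sum>b \<in> cd \<alpha>. Poly_Mapping.single (f b) 1) = content_monomial \<gamma> \<longleftrightarrow>
      (\<forall>i. card {b \<in> cd \<alpha>. f b = i} = (if i \<in> {1..length \<gamma>} then \<gamma> ! (i - 1) else 0))" for f
    unfolding poly_mapping_eq_iff fun_eq_iff lookup_content_monomial lookup_sum_single[OF finite_cd] by simp
  show ?thesis
  proof (intro equalityI subsetI)
    fix f assume f: "f \<in> ?L"
    then have fL: "f \<in> semistandard_fillings F \<alpha>"
      and card: "\<And>i. card {b \<in> cd \<alpha>. f b = i} = (if i \<in> {1..length \<gamma>} then \<gamma> ! (i - 1) else 0)"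
      using content by auto
    have "f b \<in> {1..length \<gamma>}" if b: "b \<in> cd \<alpha>" for b
    proof (rule ccontr)
      assume "f b \<notin> {1..length \<gamma>}"
      then have "card {c \<in> cd \<alpha>. f c = f b} = 0" unfolding card[of "f b"] by (rule if_not_P)
      then have "{c \<in> cd \<alpha>. f c = f b} = {}" by simp
      then show False using b by blast
    qed
    then have "f \<in> cd \<alpha> \<rightarrow>\<^sub>E {1..length \<gamma>}"
      using fL unfolding semistandard_fillings_def PiE_def by blast
    moreover have "card {b \<in> cd \<alpha>. f b = i} = \<gamma> ! (i - 1)" if "i \<in> {1..length \<gamma>}" for i
      unfolding card[of i] using that by (rule if_P)
    ultimately show "f \<in> ?R" using fL by (simp add: semistandard_fillings_def fillings_def)
  next
    fix f assume f: "f \<in> ?R"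
    then have fE: "f \<in> cd \<alpha> \<rightarrow>\<^sub>E {1..length \<gamma>}" and weak: "weak_filling F (cd \<alpha>) f"
      and card: "\<And>i. i \<in> {1..length \<gamma>} \<Longrightarrow> card {b \<in> cd \<alpha>. f b = i} = \<gamma> ! (i - 1)"
      and free: "\<And>i. i \<in> {1..length \<gamma>} \<Longrightarrow> column_free F {b \<in> cd \<alpha>. f b = i}"
      unfolding fillings_def by blast+
    have empty: "{b \<in> cd \<alpha>. f b = i} = {}" if "i \<notin> {1..length \<gamma>}" for i
      using PiE_mem[OF fE] that by blast
    have "f \<in> cd \<alpha> \<rightarrow>\<^sub>E {1..}" using fE unfolding PiE_def by auto
    moreover have "column_free F {b \<in> cd \<alpha>. f b = i}" for i
    proof (cases "i \<in> {1..length \<gamma>}")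
      case False
      then show ?thesis unfolding empty[OF False] by (simp add: column_free_def)
    qed (rule free)
    moreover have "card {b \<in> cd \<alpha>. f b = i} = (if i \<in> {1..length \<gamma>} then \<gamma> ! (i - 1) else 0)" for i
    proof (cases "i \<in> {1..length \<gamma>}")
      case False
      then show ?thesis unfolding empty[OF False] by auto
    qed (use card in simp)
    ultimately show "f \<in> ?L" using weak content by (simp add: semistandard_fillings_def)
  qed
qed

lemma Y_content_monomial:
  assumes "positive \<alpha>"
  shows "Y F \<alpha> (content_monomial \<gamma>) = weighted F (\<lambda>B. of_bool (column_free F B)) (cd \<alpha>) \<gamma>"
proof -
  have "weighted F (\<lambda>B. of_bool (column_free F B)) (cd \<alpha>) \<gamma> =
      (\<Sum>f \<in> fillings F (cd \<alpha>) \<gamma>. of_bool (\<forall>i \<in> {1..length \<gamma>}. column_free F {b \<in> cd \<alpha>. f b = i}))"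
    unfolding weighted_def
  proof (rule sum.cong[OF refl])
    fix f
    show "(\<Prod>i = 1..length \<gamma>. of_bool (column_free F {b \<in> cd \<alpha>. f b = i})) =
        (of_bool (\<forall>i \<in> {1..length \<gamma>}. column_free F {b \<in> cd \<alpha>. f b = i}) :: rat)"
    proof (cases "\<forall>i \<in> {1..length \<gamma>}. column_free F {b \<in> cd \<alpha>. f b = i}")
      case False
      then show ?thesis by (simp only: of_bool_eq) (rule prod_zero, auto)
    qed simp
  qed
  also have "\<dots> = of_nat (card {f \<in> fillings F (cd \<alpha>) \<gamma>. \<forall>i \<in> {1..length \<gamma>}. column_free F {b \<in> cd \<alpha>. f b = i}})"
    by (simp add: sum_of_bool_eq finite_fillings Int_def)
  finally show ?thesis
    unfolding Y_coefficient[OF assms] semistandard_content by simp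
qed

text \<open>All parts are positive, so the support of the monomial of \<gamma> is exactly 1 to its
  length, and the only strictly increasing index list with that support is the interval itself. The
  exponents then force \<beta> = \<gamma>.\<close>

lemma monomial_qsym_content_monomial:
  assumes "positive \<beta>" "positive \<gamma>"
  shows "monomial_qsym \<beta> (content_monomial \<gamma>) = of_bool (\<beta> = \<gamma>)"
proof -
  let ?x = "\<lambda>I :: nat list. \<Sum>j < length \<beta>. Poly_Mapping.single (I ! j) (\<beta> ! j)"
  let ?A = "{I :: nat list. length I = length \<beta> \<and> (\<forall>i \<in> set I. 1 \<le> i) \<and> sorted_wrt (<) I}"
  have look: "Poly_Mapping.lookup (?x I) (I ! j) = \<beta> ! j" if I: "I \<in> ?A" and j: "j < length \<beta>" for I j
  proof -
    have "distinct I" using I strict_sorted_iff by blast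
    then have "{k \<in> {..<length \<beta>}. I ! k = I ! j} = {j}"
      using I j by (auto simp: nth_eq_iff_index_eq)
    then show ?thesis by (simp add: lookup_sum_single)
  qed
  have eq: "I = [1..<Suc (length \<gamma>)] \<and> \<beta> = \<gamma>" if I: "I \<in> ?A" and x: "?x I = content_monomial \<gamma>" for I
  proof -
    have "set I = {1..length \<gamma>}"
    proof (intro equalityI subsetI)
      fix i assume "i \<in> set I"
      then obtain j where j: "j < length \<beta>" "i = I ! j" using I by (auto simp: in_set_conv_nth)
      then have "Poly_Mapping.lookup (content_monomial \<gamma>) i = \<beta> ! j"
        using look[OF I j(1)] x by simp
      moreover have "1 \<le> \<beta> ! j" using assms(1) j by (simp add: positive_def)
      ultimately show "i \<in> {1..length \<gamma>}" by (auto simp: lookup_content_monomial split: if_splits)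
    next
      fix i assume i: "i \<in> {1..length \<gamma>}"
      then have "i - 1 < length \<gamma>" by auto
      then have "1 \<le> \<gamma> ! (i - 1)" using assms(2) by (simp add: positive_def)
      then have "Poly_Mapping.lookup (?x I) i \<noteq> 0"
        unfolding x lookup_content_monomial using i by simp
      then have "(\<Sum>j \<in> {j \<in> {..<length \<beta>}. I ! j = i}. \<beta> ! j) \<noteq> 0" by (simp add: lookup_sum_single)
      then have "{j \<in> {..<length \<beta>}. I ! j = i} \<noteq> {}" by (metis sum.empty)
      then show "i \<in> set I" using I by force
    qed
    moreover have "sorted_wrt (<) [1..<Suc (length \<gamma>)]" by (rule sorted_wrt_upt)
    moreover have "set [1..<Suc (length \<gamma>)] = {1..length \<gamma>}" by auto
    ultimately have I_eq: "I = [1..<Suc (length \<gamma>)]"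
      using I by (intro strict_sorted_equal) auto
    then have len: "length \<beta> = length \<gamma>"
      using I by (simp del: upt_Suc)
    have "\<beta> = \<gamma>"
    proof (rule nth_equalityI[OF len])
      fix j assume j: "j < length \<beta>"
      have "I ! j = Suc j" using I_eq j len by (simp del: upt_Suc)
      then show "\<beta> ! j = \<gamma> ! j"
        using look[OF I j] j len unfolding x by (simp add: lookup_content_monomial)
    qed
    then show ?thesis using I_eq by simp
  qed
  have qsym: "monomial_qsym \<beta> (content_monomial \<gamma>) = of_nat (card {I \<in> ?A. ?x I = content_monomial \<gamma>})"
    by (simp only: monomial_qsym_def monomial_sum_def)
  show ?thesis
  proof (cases "\<beta> = \<gamma>")
    case True
    have "?x [1..<Suc (length \<gamma>)] = content_monomial \<gamma>"
      unfolding content_monomial_def True by (intro sum.cong refl) (simp del: upt_Suc)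
    moreover have "[1..<Suc (length \<gamma>)] \<in> ?A"
      using True by (auto simp del: upt_Suc)
    ultimately have single: "{I \<in> ?A. ?x I = content_monomial \<gamma>} = {[1..<Suc (length \<gamma>)]}"
      using eq by blast
    show ?thesis unfolding qsym single using True by simp
  next
    case False
    then have empty: "{I \<in> ?A. ?x I = content_monomial \<gamma>} = {}" using eq by blast
    show ?thesis unfolding qsym empty using False by simp
  qed
qed

lemma Psi_content_monomial:
  assumes "\<beta> \<in> compositions n" "\<gamma> \<in> compositions n"
  shows "Psi \<beta> (content_monomial \<gamma>) / of_nat (z_comp \<beta>) =
    (if \<beta> \<in> refinements \<gamma> then 1 / of_nat (pi_coarse \<beta> \<gamma>) else 0)"
proof -
  have pos: "positive \<beta>" "positive \<gamma>" and sums: "sum_list \<beta> = n" "sum_list \<gamma> = n"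
    using assms by (auto simp: compositions_iff)
  have fin: "finite (coarsenings \<beta>)"
    unfolding coarsenings_def by (rule finite_subset[OF _ finite_compositions]) blast
  have "Psi \<beta> (content_monomial \<gamma>) / of_nat (z_comp \<beta>) =
      (\<Sum>\<delta> \<in> coarsenings \<beta>. 1 / of_nat (pi_coarse \<beta> \<delta>) * monomial_qsym \<delta> (content_monomial \<gamma>))"
    using z_comp_pos[OF pos(1)] by (simp add: Psi_def)
  also have "\<dots> = (\<Sum>\<delta> \<in> coarsenings \<beta>. if \<delta> = \<gamma> then 1 / of_nat (pi_coarse \<beta> \<delta>) else 0)"
  proof (rule sum.cong[OF refl])
    fix \<delta> assume "\<delta> \<in> coarsenings \<beta>"
    then have "positive \<delta>" by (simp add: coarsenings_def compositions_iff)
    then show "1 / of_nat (pi_coarse \<beta> \<delta>) * monomial_qsym \<delta> (content_monomial \<gamma>) =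
        (if \<delta> = \<gamma> then 1 / of_nat (pi_coarse \<beta> \<delta>) else 0)"
      using monomial_qsym_content_monomial[OF _ pos(2)] by simp
  qed
  also have "\<dots> = (if \<gamma> \<in> coarsenings \<beta> then 1 / of_nat (pi_coarse \<beta> \<gamma>) else 0)"
    using fin by simp
  also have "\<gamma> \<in> coarsenings \<beta> \<longleftrightarrow> \<beta> \<in> refinements \<gamma>"
    using assms sums by (simp add: refinements_def)
  finally show ?thesis .
qed

text \<open>All refinements of \<gamma> other than \<gamma> are longer, and no length exceeds n, so
  the system is solved downwards from the longest compositions; the diagonal coefficients 1 /
  \<pi>(\<gamma>, \<gamma>) are nonzero.\<close>

lemma refinement_expansion_unique:
  fixes d e :: "nat list \<Rightarrow> rat"
  assumes eq: "\<And>\<gamma>. \<gamma> \<in> compositions n \<Longrightarrow>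
      (\<Sum>\<beta> \<in> refinements \<gamma>. d \<beta> / of_nat (pi_coarse \<beta> \<gamma>)) =
      (\<Sum>\<beta> \<in> refinements \<gamma>. e \<beta> / of_nat (pi_coarse \<beta> \<gamma>))"
    and "\<gamma> \<in> compositions n"
  shows "d \<gamma> = e \<gamma>"
  using assms(2)
proof (induction "n - length \<gamma>" arbitrary: \<gamma> rule: less_induct)
  case less
  have pos: "positive \<gamma>" and sum: "sum_list \<gamma> = n"
    using less.prems by (auto simp: compositions_iff)
  have other: "d \<beta> = e \<beta>" if "\<beta> \<in> refinements \<gamma> - {\<gamma>}" for \<beta>
  proof (rule less.hyps)
    show "\<beta> \<in> compositions n" using that sum by (simp add: refinements_def)
    then have "length \<beta> \<le> n" using length_le_sum_list by (auto simp: compositions_iff)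
    moreover have "length \<gamma> < length \<beta>" using refinements_length[OF pos] that by blast
    ultimately show "n - length \<beta> < n - length \<gamma>" by simp
  qed
  have self: "\<gamma> \<in> refinements \<gamma>" using pos by (simp add: refinements_iff)
  have "d \<gamma> / of_nat (pi_coarse \<gamma> \<gamma>) = e \<gamma> / of_nat (pi_coarse \<gamma> \<gamma>)"
    using eq[OF less.prems] other
    unfolding sum.remove[OF finite_refinements self] by simp
  then show ?case using pi_coarse_refl_pos[OF pos] by simp
qed

theorem corollary5p19:
  fixes Y\<^sub>0 :: family and n :: nat and \<alpha> :: "nat list" and d :: "nat list \<Rightarrow> rat"
  assumes "\<alpha> \<in> compositions n"
    and "Y Y\<^sub>0 \<alpha> = (\<lambda>m. \<Sum>\<beta> \<in> compositions n. d \<beta> * (Psi \<beta> m / of_nat (z_comp \<beta>)))"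
  shows "\<forall>\<beta> \<in> compositions n.
    d \<beta> = (\<Sum>T \<in> BST Y\<^sub>0 \<alpha> \<beta>. (-1) ^ tableau_height \<alpha> T)"
proof
  fix \<beta> assume \<beta>: "\<beta> \<in> compositions n"
  have pos: "positive \<alpha>" using assms(1) by (simp add: compositions_iff)
  \<comment> \<open>Both sides solve the same triangular system: d by the assumed expansion, the
    signed count by the iterated Newton identity, each evaluated at the monomials of all
    \<gamma>.\<close>
  have "d \<beta> = weighted Y\<^sub>0 (strip_sign Y\<^sub>0) (cd \<alpha>) \<beta>"
  proof (rule refinement_expansion_unique[OF _ \<beta>])
    fix \<gamma> assume \<gamma>: "\<gamma> \<in> compositions n"
    then have \<gamma>': "positive \<gamma>" "sum_list \<gamma> = n" by (auto simp: compositions_iff)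
    have sub: "refinements \<gamma> \<subseteq> compositions n" using \<gamma>' by (auto simp: refinements_def)
    have "(\<Sum>\<beta> \<in> refinements \<gamma>. d \<beta> / of_nat (pi_coarse \<beta> \<gamma>)) =
        (\<Sum>\<beta> \<in> compositions n. d \<beta> * (if \<beta> \<in> refinements \<gamma> then 1 / of_nat (pi_coarse \<beta> \<gamma>) else 0))"
      by (rule sum.mono_neutral_cong_left) (use sub in auto)
    also have "\<dots> = (\<Sum>\<beta> \<in> compositions n. d \<beta> * (Psi \<beta> (content_monomial \<gamma>) / of_nat (z_comp \<beta>)))"
      by (intro sum.cong refl) (simp add: Psi_content_monomial \<gamma>)
    also have "\<dots> = Y Y\<^sub>0 \<alpha> (content_monomial \<gamma>)"
      by (simp add: assms(2))
    also have "\<dots> = (\<Sum>\<beta> \<in> refinements \<gamma>. weighted Y\<^sub>0 (strip_sign Y\<^sub>0) (cd \<alpha>) \<beta> / of_nat (pi_coarse \<beta> \<gamma>))"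
      unfolding Y_content_monomial[OF pos] by (rule weighted_column_free[OF \<gamma>'(1) lower_set_cd])
    finally show "(\<Sum>\<beta> \<in> refinements \<gamma>. d \<beta> / of_nat (pi_coarse \<beta> \<gamma>)) =
      (\<Sum>\<beta> \<in> refinements \<gamma>. weighted Y\<^sub>0 (strip_sign Y\<^sub>0) (cd \<alpha>) \<beta> / of_nat (pi_coarse \<beta> \<gamma>))" .
  qed
  then show "d \<beta> = (\<Sum>T \<in> BST Y\<^sub>0 \<alpha> \<beta>. (-1) ^ tableau_height \<alpha> T)"
    by (simp add: weighted_strip_sign[OF pos])
qed

end
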